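(* There is a functional $\Phi$, computable in $\Omega_{\mathbf\Delta}+\exists^2$, such that for every $X\in\mathbf\Delta$, $\Phi(X)$ is an RM-code for $X$.
   Context: Computability means Kleene's higher-order computability via S1–S9. Kleene's quantifier $\exists^2:\mathbb N^{\mathbb N}\to\{0,1\}$ satisfies $\exists^2(f)=0\iff(\exists n)(f(n)=0)$. Subsets of $\mathbb R$ are given by characteristic functions $\mathbb R\to\{0,1\}$. $O\subseteq\mathbb R$ is open if every $x\in O$ has some $k$ with $B(x,2^{-k})\subseteq O$; closed sets are complements of open sets. $\mathbf\Delta=\mathbf F_\sigma\cap\mathbf G_\delta$ is the class of sets that are both a countable union of closed sets and a countable intersection of open sets (ambivalent sets). An RM-code of an open set is a pair of sequences of reals $(a_n),(b_n)$ with $O=\bigcup_n(a_n,b_n)$; an RM-code of a closed set is an RM-code of its complement; an RM-code for $X\in\mathbf\Delta$ is a sequence $(O_n,F_n)_n$ of RM-codes of open sets $O_n$ and closed sets $F_n$ with $X=\bigcap_nO_n=\bigcup_nF_n$. $\Omega_{\mathbf\Delta}$ is the partial functional which, on $X\in\mathbf\Delta$, returns $1$ if $X\neq\emptyset$ and $0$ if $X=\emptyset$. *)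

theory Defs
  imports "HOL-Analysis.Analysis" "HOL-Library.Nat_Bijection" "HOL-Library.Countable"
begin

section \<open>Kleene's schemes S1--S9\<close>

type_synonym type1 = "nat \<Rightarrow> nat"
type_synonym type2 = "type1 \<Rightarrow> nat"

text \<open>
  Type-3 objects may be partial; their arguments are total objects of type 2.
\<close>

type_synonym type3 = "type2 \<Rightarrow> nat option"

definition move_front :: "nat \<Rightarrow> 'a list \<Rightarrow> 'a list" where
  "move_front k l = l ! k # take k l @ drop (Suc k) l"

text \<open>
  \<open>kleene e xs fs Fs Gs m\<close> means \<open>{e}(xs, fs, Fs, Gs) = m\<close>, the arguments being listed separately
  for each of the types 0, 1, 2, 3.  Computations on arguments of type at most 3 only have
  subcomputations on arguments of type at most 3, so this is S1--S9 in full for such arguments.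
  Indices are natural numbers coding finite sequences that begin with the number of the scheme.
  As in many modern presentations the indices do not carry the numbers of arguments of each type,
  and a scheme looks only at the initial arguments that it needs.
  In S8 the function fed to the oracle has to be total, and for a partial oracle it has to belong to
  its domain; otherwise the computation has no value.
\<close>

inductive kleene ::
  "nat \<Rightarrow> nat list \<Rightarrow> type1 list \<Rightarrow> type2 list \<Rightarrow> type3 list \<Rightarrow> nat \<Rightarrow> bool" where
  S1: "kleene (list_encode [1]) (x # xs) fs Fs Gs (Suc x)"
| S2: "kleene (list_encode [2, q]) xs fs Fs Gs q"
| S3: "kleene (list_encode [3]) (x # xs) fs Fs Gs x"
| S4: "kleene e2 xs fs Fs Gs y \<Longrightarrow> kleene e1 (y # xs) fs Fs Gs z
       \<Longrightarrow> kleene (list_encode [4, e1, e2]) xs fs Fs Gs z"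
| S5_0: "kleene e1 xs fs Fs Gs z
       \<Longrightarrow> kleene (list_encode [5, e1, e2]) (0 # xs) fs Fs Gs z"
| S5_Suc: "kleene (list_encode [5, e1, e2]) (x # xs) fs Fs Gs y
       \<Longrightarrow> kleene e2 (x # y # xs) fs Fs Gs z
       \<Longrightarrow> kleene (list_encode [5, e1, e2]) (Suc x # xs) fs Fs Gs z"
| S6_0: "k < length xs \<Longrightarrow> kleene e (move_front k xs) fs Fs Gs z
       \<Longrightarrow> kleene (list_encode [6, 0, k, e]) xs fs Fs Gs z"
| S6_1: "k < length fs \<Longrightarrow> kleene e xs (move_front k fs) Fs Gs z
       \<Longrightarrow> kleene (list_encode [6, 1, k, e]) xs fs Fs Gs z"
| S6_2: "k < length Fs \<Longrightarrow> kleene e xs fs (move_front k Fs) Gs z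
       \<Longrightarrow> kleene (list_encode [6, 2, k, e]) xs fs Fs Gs z"
| S6_3: "k < length Gs \<Longrightarrow> kleene e xs fs Fs (move_front k Gs) z
       \<Longrightarrow> kleene (list_encode [6, 3, k, e]) xs fs Fs Gs z"
| S7: "kleene (list_encode [7]) (x # xs) (f # fs) Fs Gs (f x)"
| S8_2: "(\<And>n. kleene e (n # xs) fs (F # Fs) Gs (g n)) \<Longrightarrow> F g = m
       \<Longrightarrow> kleene (list_encode [8, 2, e]) xs fs (F # Fs) Gs m"
| S8_3: "(\<And>f. kleene e xs (f # fs) Fs (G # Gs) (H f)) \<Longrightarrow> G H = Some m
       \<Longrightarrow> kleene (list_encode [8, 3, e]) xs fs Fs (G # Gs) m"
| S9: "n0 \<le> length xs \<Longrightarrow> n1 \<le> length fs \<Longrightarrow> n2 \<le> length Fs \<Longrightarrow> n3 \<le> length Gs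
       \<Longrightarrow> kleene e (take n0 xs) (take n1 fs) (take n2 Fs) (take n3 Gs) z
       \<Longrightarrow> kleene (list_encode [9, n0, n1, n2, n3]) (e # xs) fs Fs Gs z"


context
  notes list_encode.simps [simp del] and list_encode_eq [simp]
begin

private inductive_cases kleene_S1E: "kleene (list_encode [1]) (x # xs) fs Fs Gs z"
private inductive_cases kleene_S2E: "kleene (list_encode [2, q]) xs fs Fs Gs z"
private inductive_cases kleene_S3E: "kleene (list_encode [3]) (x # xs) fs Fs Gs z"
private inductive_cases kleene_S4E: "kleene (list_encode [4, e1, e2]) xs fs Fs Gs z"
private inductive_cases kleene_S5_0E: "kleene (list_encode [5, e1, e2]) (0 # xs) fs Fs Gs z"
private inductive_cases kleene_S5_SucE: "kleene (list_encode [5, e1, e2]) (Suc x # xs) fs Fs Gs z"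
private inductive_cases kleene_S6_0E: "kleene (list_encode [6, 0, k, e]) xs fs Fs Gs z"
private inductive_cases kleene_S6_1E: "kleene (list_encode [6, 1, k, e]) xs fs Fs Gs z"
private inductive_cases kleene_S6_2E: "kleene (list_encode [6, 2, k, e]) xs fs Fs Gs z"
private inductive_cases kleene_S6_3E: "kleene (list_encode [6, 3, k, e]) xs fs Fs Gs z"
private inductive_cases kleene_S7E: "kleene (list_encode [7]) (x # xs) (f # fs) Fs Gs z"
private inductive_cases kleene_S8_2E: "kleene (list_encode [8, 2, e]) xs fs (F # Fs) Gs z"
private inductive_cases kleene_S8_3E: "kleene (list_encode [8, 3, e]) xs fs Fs (G # Gs) z"
private inductive_cases kleene_S9E: "kleene (list_encode [9, n0, n1, n2, n3]) (a # xs) fs Fs Gs z"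

lemma kleene_deterministic:
  "kleene e xs fs Fs Gs y \<Longrightarrow> kleene e xs fs Fs Gs z \<Longrightarrow> y = z"
proof (induction arbitrary: z rule: kleene.induct)
  case (S1 x xs fs Fs Gs)
  then show ?case by (rule kleene_S1E) simp
next
  case (S2 q xs fs Fs Gs)
  then show ?case by (rule kleene_S2E) simp
next
  case (S3 x xs fs Fs Gs)
  then show ?case by (rule kleene_S3E) simp
next
  case (S7 x xs f fs Fs Gs)
  then show ?case by (rule kleene_S7E) simp
next
  case (S4 e2 xs fs Fs Gs y e1 w)
  from S4.prems show ?case by (rule kleene_S4E) (use S4.IH in blast)
next
  case (S5_0 e1 xs fs Fs Gs w e2)
  from S5_0.prems show ?case by (rule kleene_S5_0E) (use S5_0.IH in blast)
next
  case (S5_Suc e1 e2 x xs fs Fs Gs y w)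
  from S5_Suc.prems show ?case by (rule kleene_S5_SucE) (use S5_Suc.IH in blast)
next
  case (S6_0)
  from S6_0.prems show ?case by (rule kleene_S6_0E) (use S6_0.IH in blast)
next
  case (S6_1)
  from S6_1.prems show ?case by (rule kleene_S6_1E) (use S6_1.IH in blast)
next
  case (S6_2)
  from S6_2.prems show ?case by (rule kleene_S6_2E) (use S6_2.IH in blast)
next
  case (S6_3)
  from S6_3.prems show ?case by (rule kleene_S6_3E) (use S6_3.IH in blast)
next
  case (S9)
  from S9.prems show ?case by (rule kleene_S9E) (use S9.IH in blast)
next
  case (S8_2 e xs fs F Fs Gs g m)
  from S8_2.prems have "\<exists>g'. (\<forall>n. kleene e (n # xs) fs (F # Fs) Gs (g' n)) \<and> F g' = z"
    by (rule kleene_S8_2E) (rule exI, rule conjI, rule allI, assumption+)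
  then obtain g' where g': "\<forall>n. kleene e (n # xs) fs (F # Fs) Gs (g' n)" "F g' = z"
    by (elim exE conjE)
  have "g n = g' n" for n
    by (rule S8_2.IH) (rule spec[OF g'(1)])
  then have "g = g'" by (rule ext)
  then show ?case using g'(2) S8_2.hyps by simp
next
  case (S8_3 e xs fs Fs G Gs H m)
  from S8_3.prems
  have "\<exists>H'. (\<forall>f. kleene e xs (f # fs) Fs (G # Gs) (H' f)) \<and> G H' = Some z"
    by (rule kleene_S8_3E) (rule exI, rule conjI, rule allI, assumption+)
  then obtain H' where H': "\<forall>f. kleene e xs (f # fs) Fs (G # Gs) (H' f)" "G H' = Some z"
    by (elim exE conjE)
  have "H f = H' f" for f
    by (rule S8_3.IH) (rule spec[OF H'(1)])
  then have "H = H'" by (rule ext)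
  then show ?case using H'(2) S8_3.hyps by simp
qed

end

definition exists2 :: type2 where
  "exists2 f = (if \<exists>n. f n = 0 then 0 else 1)"


section \<open>Real numbers and subsets of the real line as arguments\<close>

text \<open>
  Real numbers are given by fast converging Cauchy sequences of rationals, and rationals by the
  standard (surjective) enumeration \<^const>\<open>nat_to_rat_surj\<close>.
\<close>

definition codes_real :: "type1 \<Rightarrow> real \<Rightarrow> bool" where
  "codes_real f x \<longleftrightarrow>
     (\<forall>n i. \<bar>nat_to_rat_surj (f n) - nat_to_rat_surj (f (n + i))\<bar> < 1 / 2 ^ n) \<and>
     (\<lambda>n. of_rat (nat_to_rat_surj (f n))) \<longlonglongrightarrow> x"

text \<open>
  A characteristic function \<open>\<real> \<rightarrow> {0,1}\<close> as a type-2 object: it acts on codes of reals, respecting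
  equality of reals.  Its values at functions that do not code a real are irrelevant.
\<close>

definition char_fun :: "type2 \<Rightarrow> real set \<Rightarrow> bool" where
  "char_fun F X \<longleftrightarrow> (\<forall>f x. codes_real f x \<longrightarrow> F f = (if x \<in> X then 1 else 0))"

lemma ex_codes_real: "\<exists>f. codes_real f x"
proof -
  have "\<exists>m. x < of_rat (nat_to_rat_surj m) \<and> of_rat (nat_to_rat_surj m) < x + 1 / 2 ^ n" for n :: nat
  proof -
    obtain q where q: "x < of_rat q" "of_rat q < x + 1 / 2 ^ n"
      using of_rat_dense[of x "x + 1 / 2 ^ n"] by fastforce
    obtain m where "q = nat_to_rat_surj m" by (rule surjE[OF surj_nat_to_rat_surj])
    with q show ?thesis by blast
  qed
  then have "\<exists>f. \<forall>n. x < of_rat (nat_to_rat_surj (f n)) \<and> of_rat (nat_to_rat_surj (f n)) < x + 1 / 2 ^ n"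
    by (intro choice allI)
  then obtain f where
    f: "\<And>n. x < of_rat (nat_to_rat_surj (f n))" "\<And>n. of_rat (nat_to_rat_surj (f n)) < x + 1 / 2 ^ n"
    by blast
  have less: "\<bar>nat_to_rat_surj (f n) - nat_to_rat_surj (f (n + i))\<bar> < 1 / 2 ^ n" for n i
  proof -
    have "(1::real) / 2 ^ (n + i) \<le> 1 / 2 ^ n"
      by (rule divide_left_mono) (simp_all add: power_increasing)
    then have "\<bar>real_of_rat (nat_to_rat_surj (f n)) - of_rat (nat_to_rat_surj (f (n + i)))\<bar> < 1 / 2 ^ n"
      using f(1)[of n] f(2)[of n] f(1)[of "n + i"] f(2)[of "n + i"] by linarith
    also have "\<bar>real_of_rat (nat_to_rat_surj (f n)) - of_rat (nat_to_rat_surj (f (n + i)))\<bar>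
        = of_rat \<bar>nat_to_rat_surj (f n) - nat_to_rat_surj (f (n + i))\<bar>"
      by (simp add: abs_if of_rat_diff of_rat_less)
    also have "(1::real) / 2 ^ n = of_rat (1 / 2 ^ n)"
      by (simp add: of_rat_divide of_rat_power)
    finally show ?thesis by (simp only: of_rat_less)
  qed
  have "(\<lambda>n. x + 1 / 2 ^ n) \<longlonglongrightarrow> x + 0"
    by (intro tendsto_add tendsto_const LIMSEQ_divide_realpow_zero) simp
  then have "(\<lambda>n. x + 1 / 2 ^ n) \<longlonglongrightarrow> x" by simp
  then have "(\<lambda>n. of_rat (nat_to_rat_surj (f n))) \<longlonglongrightarrow> x"
    by (rule tendsto_sandwich[rotated 3, where f = "\<lambda>_. x"]) (simp_all add: f less_imp_le)
  then show ?thesis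
    using less unfolding codes_real_def by blast
qed

lemma char_fun_unique:
  assumes "char_fun F X" and "char_fun F Y"
  shows "X = Y"
proof (rule set_eqI)
  fix x
  obtain f where f: "codes_real f x" using ex_codes_real by blast
  have "F f = (if x \<in> X then 1 else 0)"
    using assms(1) f unfolding char_fun_def by blast
  moreover have "F f = (if x \<in> Y then 1 else 0)"
    using assms(2) f unfolding char_fun_def by blast
  ultimately have "(if x \<in> X then 1 else 0 :: nat) = (if x \<in> Y then 1 else 0)"
    by (rule trans[OF sym])
  then show "x \<in> X \<longleftrightarrow> x \<in> Y" by (cases "x \<in> X"; cases "x \<in> Y") simp_all
qed

text \<open>A partial functional on subsets of the real line, as a type-3 object.\<close>

definition type3_of :: "(real set \<Rightarrow> nat option) \<Rightarrow> type3" where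
  "type3_of \<Omega> F = (if \<exists>X. char_fun F X then \<Omega> (THE X. char_fun F X) else None)"

text \<open>
  A functional \<open>\<Phi>\<close> from subsets of the real line to \<open>\<nat>\<^sup>\<nat>\<close>, defined at least on the class \<open>D\<close>, is
  computable on \<open>D\<close> in the oracles \<open>Fs\<close>, \<open>Gs\<close> if a single index computes \<open>\<Phi> X n\<close> from \<open>n\<close>, the
  oracles, and whichever type-2 object presents \<open>X\<close>.
\<close>

definition computable_on ::
  "real set set \<Rightarrow> (real set \<Rightarrow> type1) \<Rightarrow> type2 list \<Rightarrow> type3 list \<Rightarrow> bool" where
  "computable_on D \<Phi> Fs Gs \<longleftrightarrow>
     (\<exists>e. \<forall>X \<in> D. \<forall>F. char_fun F X \<longrightarrow> (\<forall>n. kleene e [n] [] (F # Fs) Gs (\<Phi> X n)))"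


section \<open>Ambivalent sets and their codes\<close>

definition Delta :: "real set set" where
  "Delta = {X. fsigma X \<and> gdelta X}"

definition Omega_Delta :: "real set \<Rightarrow> nat option" where
  "Omega_Delta X = (if X \<in> Delta then Some (if X \<noteq> {} then 1 else 0) else None)"

text \<open>An element of \<open>\<nat>\<^sup>\<nat>\<close> viewed as a sequence of elements of \<open>\<nat>\<^sup>\<nat>\<close>.\<close>

definition row :: "type1 \<Rightarrow> nat \<Rightarrow> type1" where
  "row h i = (\<lambda>m. h (prod_encode (i, m)))"

definition codes_real_seq :: "type1 \<Rightarrow> (nat \<Rightarrow> real) \<Rightarrow> bool" where
  "codes_real_seq h a \<longleftrightarrow> (\<forall>n. codes_real (row h n) (a n))"

text \<open>Pairs of elements of \<open>\<nat>\<^sup>\<nat>\<close> are given by rows 0 and 1.\<close>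

definition RM_code_open :: "type1 \<Rightarrow> real set \<Rightarrow> bool" where
  "RM_code_open h U \<longleftrightarrow>
     (\<exists>a b. codes_real_seq (row h 0) a \<and> codes_real_seq (row h 1) b \<and> U = (\<Union>n. {a n<..<b n}))"

definition RM_code_closed :: "type1 \<Rightarrow> real set \<Rightarrow> bool" where
  "RM_code_closed h C \<longleftrightarrow> RM_code_open h (- C)"

definition RM_code_Delta :: "type1 \<Rightarrow> real set \<Rightarrow> bool" where
  "RM_code_Delta h X \<longleftrightarrow>
     (\<exists>U C. (\<forall>n. RM_code_open (row (row h n) 0) (U n) \<and> RM_code_closed (row (row h n) 1) (C n)) \<and>
            X = (\<Inter>n. U n) \<and> X = (\<Union>n. C n))"

end

theory Submission
  imports Defs
begin

text \<open>
  Let \<open>C\<^sub>0 = \<real>\<close>, and at each stage remove from the current closed set \<open>C\<close> all rational open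
  intervals \<open>I\<close> such that \<open>cl I \<inter> C\<close> is contained in \<open>X\<close> or in its complement.  For \<open>X \<in> \<Delta>\<close> the
  Baire category theorem shows that this goes on transfinitely until nothing is left, so \<open>X\<close> is
  the union of those closed sets \<open>cl I \<inter> C\<close> that it contains, and likewise for its complement.  It
  thus suffices to compute the relation ``\<open>I\<close> is removed before \<open>J\<close>'' on the rational intervals.

  No transfinite recursion is needed for this.  The relation is the only one that satisfies a local
  condition which involves, besides quantifiers over \<open>\<nat>\<close>, only the question whether \<open>X\<close> or its
  complement meets a given closed set.  For any relation at all this is a question about a set in
  \<open>\<Delta>\<close>, so \<open>\<Omega>\<close> and \<open>\<exists>\<^sup>2\<close> decide the condition.  If relations are coded by binary expansions, the
  correct relation is the only point of a subset of the unit interval.  Requiring one digit to be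
  \<open>1\<close> leaves a finite set, which is in \<open>\<Delta>\<close>, and \<open>\<Omega>\<close> applied to it returns this digit.
\<close>

section \<open>Closure properties of Kleene computability\<close>

text \<open>Scheme S8 has no value where \<open>Omega_Delta\<close> is undefined, so indices are
  only asked to converge when the set argument is ambivalent.\<close>

definition presents_Delta :: "type2 \<Rightarrow> bool" where
  "presents_Delta F \<longleftrightarrow> (\<exists>X\<in>Delta. char_fun F X)"

text \<open>In \<open>t F v w\<close> the variables of types 0 and 1 are \<open>v 0, v 1, \<dots>\<close> and \<open>w 0, w 1, \<dots>\<close>, in de
  Bruijn style: \<open>k\<close> and \<open>l\<close> of them are in use, and a bound variable is put in front.\<close>

definition computable :: "nat \<Rightarrow> nat \<Rightarrow> (type2 \<Rightarrow> (nat \<Rightarrow> nat) \<Rightarrow> (nat \<Rightarrow> type1) \<Rightarrow> nat) \<Rightarrow> bool" where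
  "computable k l t \<longleftrightarrow> (\<exists>e. \<forall>F v w. presents_Delta F \<longrightarrow>
     kleene e (map v [0..<k]) (map w [0..<l]) [F, exists2] [type3_of Omega_Delta] (t F v w))"

text \<open>Truth is \<open>0\<close>, as in the convention for \<^const>\<open>exists2\<close>.\<close>

definition decidable :: "nat \<Rightarrow> nat \<Rightarrow> (type2 \<Rightarrow> (nat \<Rightarrow> nat) \<Rightarrow> (nat \<Rightarrow> type1) \<Rightarrow> bool) \<Rightarrow> bool" where
  "decidable k l P \<longleftrightarrow> computable k l (\<lambda>F v w. if P F v w then 0 else 1)"

lemma map_case_nat_upt: "map (case_nat y v) [0..<Suc k] = y # map v [0..<k]"
  by (simp add: upt_conv_Cons map_Suc_upt[symmetric] del: upt_Suc)

lemma computableI: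
  assumes "\<And>F v w. presents_Delta F \<Longrightarrow>
     kleene e (map v [0..<k]) (map w [0..<l]) [F, exists2] [type3_of Omega_Delta] (t F v w)"
  shows "computable k l t"
  using assms unfolding computable_def by blast

lemma move_front_map_upt:
  "i < k \<Longrightarrow> move_front i (map v [0..<k]) = v i # take i (map v [0..<k]) @ drop (Suc i) (map v [0..<k])"
  by (simp add: move_front_def)

section \<open>Constants, variables, composition and recursion\<close>

lemma computable_const: "computable k l (\<lambda>F v w. q)"
  by (rule computableI) (rule kleene.S2)

lemma computable_var:
  assumes "i < k" shows "computable k l (\<lambda>F v w. v i)"
proof (rule computableI)
  fix F v w
  show "kleene (list_encode [6, 0, i, list_encode [3]]) (map v [0..<k]) (map w [0..<l])
      [F, exists2] [type3_of Omega_Delta] (v i)"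
    using assms by (intro kleene.S6_0) (simp_all only: move_front_map_upt kleene.S3 length_map
        length_upt diff_zero)
qed

text \<open>Composition by S4. Successor, application and recursion act on the leading number only;
  binding a value there lets them be applied to arbitrary terms.\<close>

lemma computable_let:
  assumes "computable k l t" and "computable (Suc k) l (\<lambda>F v w. s F (v 0) (\<lambda>i. v (Suc i)) w)"
  shows "computable k l (\<lambda>F v w. s F (t F v w) v w)"
proof -
  obtain e2 where e2: "\<And>F v w. presents_Delta F \<Longrightarrow>
     kleene e2 (map v [0..<k]) (map w [0..<l]) [F, exists2] [type3_of Omega_Delta] (t F v w)"
    using assms(1) unfolding computable_def by blast
  obtain e1 where e1: "\<And>F v w. presents_Delta F \<Longrightarrow>
     kleene e1 (map v [0..<Suc k]) (map w [0..<l]) [F, exists2] [type3_of Omega_Delta]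
       (s F (v 0) (\<lambda>i. v (Suc i)) w)"
    using assms(2) unfolding computable_def by blast
  show ?thesis
  proof (rule computableI)
    fix F v w
    assume F: "presents_Delta F"
    from e1[OF F, of "case_nat (t F v w) v" w]
    have "kleene e1 (t F v w # map v [0..<k]) (map w [0..<l]) [F, exists2] [type3_of Omega_Delta]
       (s F (t F v w) v w)"
      by (simp only: map_case_nat_upt nat.case)
    with e2[OF F] show "kleene (list_encode [4, e1, e2]) (map v [0..<k]) (map w [0..<l])
      [F, exists2] [type3_of Omega_Delta] (s F (t F v w) v w)"
      by (rule kleene.S4)
  qed
qed

lemma computable_Suc: "computable k l t \<Longrightarrow> computable k l (\<lambda>F v w. Suc (t F v w))"
proof (erule computable_let)
  show "computable (Suc k) l (\<lambda>F v w. Suc (v 0))"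
  proof (rule computableI)
    fix F v w
    show "kleene (list_encode [1]) (map v [0..<Suc k]) (map w [0..<l])
      [F, exists2] [type3_of Omega_Delta] (Suc (v 0))"
      by (simp only: upt_conv_Cons zero_less_Suc list.map kleene.S1)
  qed
qed

lemma computable_app:
  assumes "i < l" "computable k l t" shows "computable k l (\<lambda>F v w. w i (t F v w))"
  using assms(2)
proof (rule computable_let)
  show "computable (Suc k) l (\<lambda>F v w. w i (v 0))"
  proof (rule computableI)
    fix F v w
    have "kleene (list_encode [7]) (map v [0..<Suc k]) (move_front i (map w [0..<l]))
      [F, exists2] [type3_of Omega_Delta] (w i (v 0))"
      by (simp only: move_front_map_upt[OF assms(1)] upt_conv_Cons zero_less_Suc list.map kleene.S7)
    then show "kleene (list_encode [6, 1, i, list_encode [7]]) (map v [0..<Suc k]) (map w [0..<l])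
      [F, exists2] [type3_of Omega_Delta] (w i (v 0))"
      by (rule kleene.S6_1[rotated]) (simp add: assms(1))
  qed
qed

lemma kleene_rec:
  assumes "kleene e1 xs fs Fs Gs z" and "\<And>x y. kleene e2 (x # y # xs) fs Fs Gs (s x y)"
  shows "kleene (list_encode [5, e1, e2]) (n # xs) fs Fs Gs (rec_nat z s n)"
proof (induction n)
  case 0
  show ?case using kleene.S5_0[OF assms(1)] by (simp only: nat.rec)
next
  case (Suc n)
  show ?case using kleene.S5_Suc[OF Suc assms(2)] by (simp only: nat.rec)
qed

lemma rec_nat_const: "rec_nat z (\<lambda>x y. y) n = z"
  by (induction n) simp_all

text \<open>A leading argument is dropped by a recursion on it that never changes the initial value.\<close>

lemma computable_shift:
  assumes "computable k l t"
  shows "computable (Suc k) l (\<lambda>F v w. t F (\<lambda>i. v (Suc i)) w)"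
proof -
  obtain e where e: "\<And>F v w. presents_Delta F \<Longrightarrow>
     kleene e (map v [0..<k]) (map w [0..<l]) [F, exists2] [type3_of Omega_Delta] (t F v w)"
    using assms unfolding computable_def by blast
  show ?thesis
  proof (rule computableI)
    fix F v w
    assume F: "presents_Delta F"
    have "kleene (list_encode [6, 0, 1, list_encode [3]]) (x # y # xs) fs Fs Gs y" for x y xs fs Fs Gs
      by (rule kleene.S6_0) (simp_all add: move_front_def kleene.S3 del: list_encode.simps)
    from kleene_rec[OF e[OF F] this]
    show "kleene (list_encode [5, e, list_encode [6, 0, 1, list_encode [3]]])
      (map v [0..<Suc k]) (map w [0..<l]) [F, exists2] [type3_of Omega_Delta] (t F (\<lambda>i. v (Suc i)) w)"
      by (simp only: rec_nat_const map_upt_Suc) 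
  qed
qed

lemma computable_rec:
  assumes "computable k l t" "computable k l z"
    and "computable (Suc (Suc k)) l (\<lambda>F v w. s F (v 0) (v (Suc 0)) (\<lambda>i. v (Suc (Suc i))) w)"
  shows "computable k l (\<lambda>F v w. rec_nat (z F v w) (\<lambda>x y. s F x y v w) (t F v w))"
  using assms(1)
proof (rule computable_let)
  obtain e1 where e1: "\<And>F v w. presents_Delta F \<Longrightarrow>
     kleene e1 (map v [0..<k]) (map w [0..<l]) [F, exists2] [type3_of Omega_Delta] (z F v w)"
    using assms(2) unfolding computable_def by blast
  obtain e2 where e2: "\<And>F v w. presents_Delta F \<Longrightarrow>
     kleene e2 (map v [0..<Suc (Suc k)]) (map w [0..<l]) [F, exists2] [type3_of Omega_Delta]
       (s F (v 0) (v (Suc 0)) (\<lambda>i. v (Suc (Suc i))) w)"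
    using assms(3) unfolding computable_def by blast
  show "computable (Suc k) l (\<lambda>F v w. rec_nat (z F (\<lambda>i. v (Suc i)) w)
           (\<lambda>x y. s F x y (\<lambda>i. v (Suc i)) w) (v 0))"
  proof (rule computableI)
    fix F v w
    assume F: "presents_Delta F"
    have "kleene e2 (x # y # map v [0..<k]) (map w [0..<l]) [F, exists2] [type3_of Omega_Delta]
       (s F x y v w)" for x y v
      using e2[OF F, of "case_nat x (case_nat y v)" w] by (simp only: map_case_nat_upt nat.case)
    from kleene_rec[where s = "\<lambda>x y. s F x y (\<lambda>i. v (Suc i)) w", OF e1[OF F] this]
    show "kleene (list_encode [5, e1, e2])
      (map v [0..<Suc k]) (map w [0..<l]) [F, exists2] [type3_of Omega_Delta]
      (rec_nat (z F (\<lambda>i. v (Suc i)) w) (\<lambda>x y. s F x y (\<lambda>i. v (Suc i)) w) (v 0))"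
      by (simp only: map_upt_Suc) 
  qed
qed

section \<open>Calls to the oracles\<close>

lemma kleene_swap:
  assumes "kleene e xs fs (G # F # Fs) Gs z"
  shows "kleene (list_encode [6, 2, 1, e]) xs fs (F # G # Fs) Gs z"
proof (rule kleene.S6_2)
  show "kleene e xs fs (move_front 1 (F # G # Fs)) Gs z"
    using assms by (simp add: move_front_def)
qed simp

lemma decidable_ex:
  assumes "decidable (Suc k) l (\<lambda>F v w. P F (v 0) (\<lambda>i. v (Suc i)) w)"
  shows "decidable k l (\<lambda>F v w. \<exists>n. P F n v w)"
proof -
  obtain e where e: "\<And>F v w. presents_Delta F \<Longrightarrow>
     kleene e (map v [0..<Suc k]) (map w [0..<l]) [F, exists2] [type3_of Omega_Delta]
       (if P F (v 0) (\<lambda>i. v (Suc i)) w then 0 else 1)"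
    using assms unfolding decidable_def computable_def by blast
  show ?thesis unfolding decidable_def
  proof (rule computableI)
    fix F v w
    assume F: "presents_Delta F"
    \<comment> \<open>S8 calls the oracle that stands first: the outer swap puts
      \<open>exists2\<close> there, and the inner one restores the order that \<open>e\<close>
      expects.\<close>
    show "kleene (list_encode [6, 2, 1, list_encode [8, 2, list_encode [6, 2, 1, e]]])
      (map v [0..<k]) (map w [0..<l]) [F, exists2] [type3_of Omega_Delta]
      (if \<exists>n. P F n v w then 0 else 1)"
    proof (intro kleene_swap kleene.S8_2)
      show "kleene e (n # map v [0..<k]) (map w [0..<l]) [F, exists2] [type3_of Omega_Delta]
        (if P F n v w then 0 else 1)" for n
        using e[OF F, of "case_nat n v" w] by (simp only: map_case_nat_upt nat.case)
      show "exists2 (\<lambda>n. if P F n v w then 0 else 1) = (if \<exists>n. P F n v w then 0 else 1)"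
        by (auto simp: exists2_def)
    qed
  qed
qed

lemma computable_oracle:
  assumes "i < l"
  shows "computable k l (\<lambda>F v w. F (w i))"
proof (rule computableI)
  fix F v w
  have "kleene (list_encode [6, 1, i, list_encode [7]]) (n # map v [0..<k]) (map w [0..<l])
      [F, exists2] [type3_of Omega_Delta] (w i n)" for n
  proof (rule kleene.S6_1)
    show "kleene (list_encode [7]) (n # map v [0..<k]) (move_front i (map w [0..<l]))
      [F, exists2] [type3_of Omega_Delta] (w i n)"
      by (simp only: move_front_map_upt[OF assms(1)] kleene.S7)
  qed (simp add: assms)
  then show "kleene (list_encode [8, 2, list_encode [6, 1, i, list_encode [7]]])
      (map v [0..<k]) (map w [0..<l]) [F, exists2] [type3_of Omega_Delta] (F (w i))"
    by (rule kleene.S8_2) (rule refl)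
qed

lemma computable_neg:
  assumes "computable k l t" shows "computable k l (\<lambda>F v w. rec_nat 1 (\<lambda>_ _. 0) (t F v w))"
  by (intro computable_rec computable_const assms)

lemma decidable_not:
  assumes "decidable k l P" shows "decidable k l (\<lambda>F v w. \<not> P F v w)"
proof -
  have "rec_nat 1 (\<lambda>_ _. 0) (if b then 0 else 1) = (if \<not> b then 0 else 1 :: nat)" for b
    by simp
  then show ?thesis
    using computable_neg[OF assms[unfolded decidable_def]] unfolding decidable_def by (simp only:)
qed

lemma type3_of_char_fun: "char_fun F X \<Longrightarrow> type3_of \<Omega> F = \<Omega> X"
  unfolding type3_of_def by (metis char_fun_unique the_equality)

text \<open>The values of \<open>P\<close> form a total type-2 object that agrees on codes of reals
  with the characteristic function of some \<open>Y\<close> in \<open>Delta\<close>, so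
  \<open>Omega_Delta\<close> converges on it. The set \<open>Y\<close> may vary with the parameters,
  while the index does not.\<close>

lemma decidable_Omega:
  assumes P: "decidable k (Suc l) (\<lambda>F v w. P F v (w 0) (\<lambda>i. w (Suc i)))"
    and Delta: "\<And>F v w. presents_Delta F \<Longrightarrow>
      \<exists>Y\<in>Delta. \<forall>f y. codes_real f y \<longrightarrow> P F v f w = (y \<in> Y)"
  shows "decidable k l (\<lambda>F v w. \<exists>f y. codes_real f y \<and> P F v f w)"
proof -
  \<comment> \<open>Truth is \<open>0\<close> for \<open>decidable\<close> but membership is
    \<open>1\<close> for \<open>char_fun\<close>; hence one negation before the oracle call and
    another after it.\<close>
  obtain e where e: "\<And>F v w. presents_Delta F \<Longrightarrow>
     kleene e (map v [0..<k]) (map w [0..<Suc l]) [F, exists2] [type3_of Omega_Delta]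
       (rec_nat 1 (\<lambda>_ _. 0) (if P F v (w 0) (\<lambda>i. w (Suc i)) then 0 else 1))"
    using computable_neg[OF P[unfolded decidable_def]] unfolding computable_def by blast
  have "computable k l (\<lambda>F v w. if \<exists>f y. codes_real f y \<and> P F v f w then 1 else 0)"
  proof (rule computableI)
    fix F v w
    assume F: "presents_Delta F"
    define H where "H f = (if P F v f w then 1 else 0 :: nat)" for f
    obtain Y where Y: "Y \<in> Delta" "\<And>f y. codes_real f y \<Longrightarrow> P F v f w = (y \<in> Y)"
      using Delta[OF F] by blast
    have "char_fun H Y"
      unfolding char_fun_def H_def using Y(2) by simp
    then have \<Omega>: "type3_of Omega_Delta H = Some (if Y \<noteq> {} then 1 else 0)"
      using Y(1) by (simp add: type3_of_char_fun Omega_Delta_def)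
    have "(Y \<noteq> {}) = (\<exists>f y. codes_real f y \<and> P F v f w)"
      using Y(2) ex_codes_real by (metis equals0I empty_iff)
    with \<Omega> have \<Omega>': "type3_of Omega_Delta H =
        Some (if \<exists>f y. codes_real f y \<and> P F v f w then 1 else 0)"
      by simp
    have "kleene e (map v [0..<k]) (f # map w [0..<l]) [F, exists2] [type3_of Omega_Delta] (H f)" for f
    proof -
      have "rec_nat 1 (\<lambda>_ _. 0) (if P F v f w then 0 else 1 :: nat) = H f"
        by (simp add: H_def)
      then show ?thesis
        using e[OF F, of v "case_nat f w"] by (simp only: map_case_nat_upt nat.case)
    qed
    then show "kleene (list_encode [8, 3, e]) (map v [0..<k]) (map w [0..<l]) [F, exists2]
        [type3_of Omega_Delta] (if \<exists>f y. codes_real f y \<and> P F v f w then 1 else 0)"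
      by (rule kleene.S8_3) (rule \<Omega>')
  qed
  moreover have "rec_nat 1 (\<lambda>_ _. 0) (if b then 1 else 0) = (if b then 0 else 1 :: nat)" for b
    by simp
  ultimately show ?thesis
    using computable_neg[of k l "\<lambda>F v w. if \<exists>f y. codes_real f y \<and> P F v f w then 1 else 0"]
    unfolding decidable_def by (simp only:)
qed

section \<open>Arithmetic, connectives and pairing\<close>

lemma computable_add:
  assumes "computable k l s" "computable k l t" shows "computable k l (\<lambda>F v w. s F v w + t F v w)"
proof -
  have "rec_nat a (\<lambda>x y. Suc y) b = a + b" for a b :: nat
    by (induction b) simp_all
  moreover have "computable k l (\<lambda>F v w. rec_nat (s F v w) (\<lambda>x y. Suc y) (t F v w))"
    by (intro computable_rec computable_Suc computable_var assms) simp
  ultimately show ?thesis by (simp only:)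
qed

lemma computable_mult:
  assumes "computable k l s" "computable k l t" shows "computable k l (\<lambda>F v w. s F v w * t F v w)"
proof -
  have "rec_nat 0 (\<lambda>x y. y + a) b = a * b" for a b :: nat
    by (induction b) simp_all
  moreover have "computable k l (\<lambda>F v w. rec_nat 0 (\<lambda>x y. y + s F v w) (t F v w))"
    by (intro computable_rec computable_add computable_const computable_var computable_shift
        assms) simp
  ultimately show ?thesis by (simp only:)
qed

lemma computable_pow2:
  assumes "computable k l t" shows "computable k l (\<lambda>F v w. 2 ^ t F v w)"
proof -
  have "rec_nat 1 (\<lambda>x y. y + y) b = (2::nat) ^ b" for b
    by (induction b) simp_all
  moreover have "computable k l (\<lambda>F v w. rec_nat 1 (\<lambda>x y. y + y) (t F v w))"
    by (intro computable_rec computable_add computable_const computable_var assms) simp_all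
  ultimately show ?thesis by (simp only:)
qed

lemma computable_pred:
  assumes "computable k l t" shows "computable k l (\<lambda>F v w. t F v w - 1)"
proof -
  have "rec_nat 0 (\<lambda>x y. x) b = b - 1" for b
    by (induction b) simp_all
  moreover have "computable k l (\<lambda>F v w. rec_nat 0 (\<lambda>x y. x) (t F v w))"
    by (intro computable_rec computable_const computable_var assms) simp_all
  ultimately show ?thesis by (simp only:)
qed

lemma computable_diff:
  assumes "computable k l s" "computable k l t" shows "computable k l (\<lambda>F v w. s F v w - t F v w)"
proof -
  have "rec_nat a (\<lambda>x y. y - 1) b = a - b" for a b :: nat
    by (induction b) simp_all
  moreover have "computable k l (\<lambda>F v w. rec_nat (s F v w) (\<lambda>x y. y - 1) (t F v w))"
    by (intro computable_rec computable_pred computable_var assms) simp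
  ultimately show ?thesis by (simp only:)
qed

lemma computable_if:
  assumes "decidable k l P" "computable k l s" "computable k l t"
  shows "computable k l (\<lambda>F v w. if P F v w then s F v w else t F v w)"
proof -
  have "rec_nat a (\<lambda>_ _. b) (if c then 0 else 1) = (if c then a else b)" for a b :: nat and c
    by simp
  moreover have "computable k l (\<lambda>F v w. rec_nat (s F v w) (\<lambda>_ _. t F v w) (if P F v w then 0 else 1))"
    using assms(1) unfolding decidable_def by (intro computable_rec computable_shift assms)
  ultimately show ?thesis by (simp only:)
qed

lemma decidable_eq_0:
  assumes "computable k l t" shows "decidable k l (\<lambda>F v w. t F v w = 0)"
proof -
  have "rec_nat 0 (\<lambda>_ _. 1) b = (if b = 0 then 0 else 1 :: nat)" for b :: nat
    by (cases b) simp_all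
  moreover have "computable k l (\<lambda>F v w. rec_nat 0 (\<lambda>_ _. 1) (t F v w))"
    by (intro computable_rec computable_const assms)
  ultimately show ?thesis unfolding decidable_def by (simp only:)
qed

lemma decidable_le:
  assumes "computable k l s" "computable k l t" shows "decidable k l (\<lambda>F v w. s F v w \<le> t F v w)"
  using decidable_eq_0[OF computable_diff[OF assms]] by simp

lemma decidable_less:
  assumes "computable k l s" "computable k l t" shows "decidable k l (\<lambda>F v w. s F v w < t F v w)"
  using decidable_not[OF decidable_le[OF assms(2,1)]] by (simp only: not_le)

lemma decidable_conj:
  assumes "decidable k l P" "decidable k l Q" shows "decidable k l (\<lambda>F v w. P F v w \<and> Q F v w)"
proof -
  have "(if a then 0 else 1 :: nat) + (if b then 0 else 1 :: nat) = 0 \<longleftrightarrow> a \<and> b" for a b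
    by simp
  with decidable_eq_0[OF computable_add[OF assms[unfolded decidable_def]]] show ?thesis by (simp only:)
qed

lemma decidable_eq:
  assumes "computable k l s" "computable k l t" shows "decidable k l (\<lambda>F v w. s F v w = t F v w)"
  using decidable_conj[OF decidable_le[OF assms] decidable_le[OF assms(2,1)]] by (simp only: eq_iff)

lemma decidable_disj:
  assumes "decidable k l P" "decidable k l Q" shows "decidable k l (\<lambda>F v w. P F v w \<or> Q F v w)"
  using decidable_not[OF decidable_conj[OF decidable_not[OF assms(1)] decidable_not[OF assms(2)]]]
  by (simp only: de_Morgan_conj not_not)

lemma decidable_imp:
  assumes "decidable k l P" "decidable k l Q" shows "decidable k l (\<lambda>F v w. P F v w \<longrightarrow> Q F v w)"
  using decidable_disj[OF decidable_not[OF assms(1)] assms(2)] by (simp only: imp_conv_disj)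

lemma decidable_iff:
  assumes "decidable k l P" "decidable k l Q" shows "decidable k l (\<lambda>F v w. P F v w \<longleftrightarrow> Q F v w)"
  using decidable_conj[OF decidable_imp[OF assms] decidable_imp[OF assms(2,1)]] by (simp only:
      iff_conv_conj_imp)

lemma decidable_all:
  assumes "decidable (Suc k) l (\<lambda>F v w. P F (v 0) (\<lambda>i. v (Suc i)) w)"
  shows "decidable k l (\<lambda>F v w. \<forall>n. P F n v w)"
  using decidable_not[OF decidable_ex[OF decidable_not[OF assms]]] by simp

lemma computable_prod_encode:
  assumes "computable k l s" "computable k l t"
  shows "computable k l (\<lambda>F v w. prod_encode (s F v w, t F v w))"
proof -
  have "rec_nat 0 (\<lambda>x y. y + Suc x) n = triangle n" for n
    by (induction n) simp_all
  then have "rec_nat 0 (\<lambda>x y. y + Suc x) (a + b) + a = prod_encode (a, b)" for a b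
    by (simp add: prod_encode_def)
  moreover have "computable k l (\<lambda>F v w. rec_nat 0 (\<lambda>x y. y + Suc x) (s F v w + t F v w) + s F v w)"
    by (intro computable_rec computable_add computable_Suc computable_const computable_var assms)
        simp_all
  ultimately show ?thesis by (simp only:)
qed

text \<open>Bounded search by primitive recursion: the last hit among \<open>0, ..., n\<close> is
  kept, and \<open>r\<close> is the only one.\<close>

lemma rec_nat_search:
  assumes "\<And>x. P x \<longleftrightarrow> x = r" and "r \<le> n"
  shows "rec_nat 0 (\<lambda>x y. if P x then x else y) (Suc n) = r"
proof -
  have "rec_nat 0 (\<lambda>x y. if P x then x else y) m = (if r < m then r else 0)" for m
    unfolding assms(1) by (induction m) auto
  from this[of "Suc n"] show ?thesis using assms(2) by (simp only: less_Suc_eq_le if_True)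
qed

lemma computable_fst_prod_decode:
  assumes "computable k l t" shows "computable k l (\<lambda>F v w. fst (prod_decode (t F v w)))"
proof -
  have "rec_nat 0 (\<lambda>x y. if \<exists>b. prod_encode (x, b) = n then x else y) (Suc n)
      = fst (prod_decode n)" for n
    by (rule rec_nat_search) (metis fst_conv prod.collapse prod_decode_inverse prod_encode_inverse,
      metis le_prod_encode_1 prod.collapse prod_decode_inverse)
  moreover have "computable k l (\<lambda>F v w. rec_nat 0
      (\<lambda>x y. if \<exists>b. prod_encode (x, b) = t F v w then x else y) (Suc (t F v w)))"
    by (rule computable_rec computable_if decidable_ex decidable_eq computable_prod_encode
        computable_Suc computable_const computable_var assms | rule computable_shift | simp)+
  ultimately show ?thesis by (simp only:)
qed

lemma computable_snd_prod_decode: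
  assumes "computable k l t" shows "computable k l (\<lambda>F v w. snd (prod_decode (t F v w)))"
proof -
  have "rec_nat 0 (\<lambda>x y. if \<exists>a. prod_encode (a, x) = n then x else y) (Suc n)
      = snd (prod_decode n)" for n
    by (rule rec_nat_search) (metis snd_conv prod.collapse prod_decode_inverse prod_encode_inverse,
      metis le_prod_encode_2 prod.collapse prod_decode_inverse)
  moreover have "computable k l (\<lambda>F v w. rec_nat 0
      (\<lambda>x y. if \<exists>a. prod_encode (a, x) = t F v w then x else y) (Suc (t F v w)))"
    by (rule computable_rec computable_if decidable_ex decidable_eq computable_prod_encode
        computable_Suc computable_const computable_var assms | rule computable_shift | simp)+
  ultimately show ?thesis by (simp only:)
qed

section \<open>The stages of an ambivalent set\<close>

definition rat_at :: "nat \<Rightarrow> real" where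
  "rat_at a = of_rat (nat_to_rat_surj a)"

definition lower :: "nat \<Rightarrow> real" where "lower m = rat_at (fst (prod_decode m))"
definition upper :: "nat \<Rightarrow> real" where "upper m = rat_at (snd (prod_decode m))"

definition uncovered :: "nat set \<Rightarrow> real set" where
  "uncovered W = - (\<Union>i\<in>W. {lower i<..<upper i})"

definition homogeneous :: "real set \<Rightarrow> real set \<Rightarrow> bool" where
  "homogeneous X Y \<longleftrightarrow> Y \<subseteq> X \<or> Y \<subseteq> - X"

text \<open>\<open>W\<close> stands for the intervals removed so far, the value for those that may
  be removed next. Closed intervals keep the pieces closed, so that \<open>X\<close> can be
  assembled from them as an F-sigma set.\<close>

definition settled :: "real set \<Rightarrow> nat set \<Rightarrow> nat set" where
  "settled X W = {j. homogeneous X ({lower j..upper j} \<inter> uncovered W)}"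

text \<open>\<open>R i k\<close> is meant to say that the interval \<open>i\<close> is removed at an earlier stage than \<open>k\<close>.\<close>

definition stage_order :: "real set \<Rightarrow> (nat \<Rightarrow> nat \<Rightarrow> bool) \<Rightarrow> bool" where
  "stage_order X R \<longleftrightarrow>
     (\<forall>a b c. R a b \<longrightarrow> R a c \<or> R c b) \<and> (\<forall>j k. \<not> R k j \<longleftrightarrow> j \<in> settled X {i. R i k})"

lemma ex_rat_at: "x < y \<Longrightarrow> \<exists>a. x < rat_at a \<and> rat_at a < y"
proof -
  assume "x < y"
  then obtain q where q: "x < of_rat q" "of_rat q < y" using of_rat_dense by blast
  obtain a where "q = nat_to_rat_surj a" by (rule surjE[OF surj_nat_to_rat_surj])
  with q show ?thesis unfolding rat_at_def by blast
qed

lemma ex_interval: "\<exists>m. lower m = rat_at a \<and> upper m = rat_at b"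
  by (rule exI[of _ "prod_encode (a, b)"]) (simp add: lower_def upper_def)

lemma closed_uncovered: "closed (uncovered W)"
  unfolding uncovered_def by (intro closed_Compl open_UN ballI open_greaterThanLessThan)

lemma uncovered_antimono: "V \<subseteq> W \<Longrightarrow> uncovered W \<subseteq> uncovered V"
  unfolding uncovered_def by blast

lemma homogeneous_subset: "homogeneous X Z \<Longrightarrow> Y \<subseteq> Z \<Longrightarrow> homogeneous X Y"
  unfolding homogeneous_def by blast

lemma settled_mono: "V \<subseteq> W \<Longrightarrow> settled X V \<subseteq> settled X W"
proof
  fix j
  assume "V \<subseteq> W" "j \<in> settled X V"
  then show "j \<in> settled X W"
    unfolding settled_def mem_Collect_eq
    by (elim homogeneous_subset) (intro Int_mono uncovered_antimono subset_refl)
qed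

section \<open>Baire category, well-foundedness and uniqueness\<close>

lemma Delta_Compl: "X \<in> Delta \<Longrightarrow> - X \<in> Delta"
  unfolding Delta_def by (simp add: fsigma_imp_gdelta gdelta_imp_fsigma)

text \<open>\<open>D\<close> is covered by closed sets \<open>A n\<close> inside \<open>X\<close>
  and \<open>B n\<close> inside \<open>- X\<close>. If all \<open>D - A n\<close> and
  \<open>D - B n\<close> were dense in \<open>D\<close>, Baire's theorem would make their empty
  intersection dense. So one of these closed sets contains a nonempty relatively open part of
  \<open>D\<close>.\<close>

lemma ex_homogeneous_interval:
  assumes "X \<in> Delta" "closed D" "D \<noteq> {}"
  obtains m where "{lower m<..<upper m} \<inter> D \<noteq> {}" "homogeneous X ({lower m..upper m} \<inter> D)"
proof -
  have "fsigma X" "fsigma (- X)"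
    using assms(1) gdelta_imp_fsigma unfolding Delta_def by auto
  then obtain A B :: "nat \<Rightarrow> real set" where A: "\<And>n. closed (A n)" "X = (\<Union>n. A n)"
    and B: "\<And>n. closed (B n)" "- X = (\<Union>n. B n)"
    unfolding fsigma.simps by blast
  define \<G> where "\<G> = range (\<lambda>n. D - A n) \<union> range (\<lambda>n. D - B n)"
  have "\<exists>E. E \<in> range A \<union> range B \<and> \<not> D \<subseteq> closure (D - E)"
  proof (rule ccontr)
    assume "\<not> ?thesis"
    then have dense: "D \<subseteq> closure T" if "T \<in> \<G>" for T
      using that unfolding \<G>_def by blast
    have "openin (top_of_set D) T" if "T \<in> \<G>" for T
      using that A(1) B(1) unfolding \<G>_def
      by (auto simp: Diff_eq intro!: openin_open_Int)
    moreover have "countable \<G>"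
      unfolding \<G>_def by simp
    ultimately have "D \<subseteq> closure (\<Inter>\<G>)"
      using dense by (intro Baire assms(2)) auto
    moreover have "\<Inter>\<G> = {}"
    proof -
      have "x \<notin> \<Inter>\<G>" for x
      proof
        assume x: "x \<in> \<Inter>\<G>"
        have "x \<in> D - A n" "x \<in> D - B n" for n
          using x by (rule InterD, simp add: \<G>_def)+
        then have "x \<notin> X" "x \<notin> - X"
          unfolding B(2) unfolding A(2) by simp_all
        then show False by simp
      qed
      then show ?thesis by blast
    qed
    ultimately show False using assms(3) by simp
  qed
  then obtain E where E: "E \<in> range A \<union> range B" "\<not> D \<subseteq> closure (D - E)" by blast
  then obtain x where x: "x \<in> D" "x \<notin> closure (D - E)" by blast
  then obtain e where e: "e > 0" "\<And>y. y \<in> D - E \<Longrightarrow> \<not> dist y x < e"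
    unfolding closure_approachable by blast
  \<comment> \<open>Endpoints within distance \<open>e\<close> of \<open>x\<close> keep even the
    closed interval in the neighbourhood where \<open>D\<close> lies inside
    \<open>E\<close>.\<close>
  obtain a where a: "x - e < rat_at a" "rat_at a < x" using ex_rat_at[of "x - e" x] e(1) by auto
  obtain b where b: "x < rat_at b" "rat_at b < x + e" using ex_rat_at[of x "x + e"] e(1) by auto
  obtain m where m: "lower m = rat_at a" "upper m = rat_at b" using ex_interval by blast
  have "{lower m..upper m} \<inter> D \<subseteq> E"
    using e(2) a b by (fastforce simp: m dist_real_def)
  then have "homogeneous X ({lower m..upper m} \<inter> D)"
    using E(1) A(2) B(2) unfolding homogeneous_def by blast
  moreover have "{lower m<..<upper m} \<inter> D \<noteq> {}"
    using x(1) a(2) b(1) by (auto simp: m)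
  ultimately show ?thesis using that by blast
qed

text \<open>Read \<open>\<not> R k j\<close> as: \<open>j\<close> is removed no later than
  \<open>k\<close>. If \<open>N\<close> had no minimal element, let \<open>W\<close> be the
  intervals preceding all of \<open>N\<close>. Some \<open>i\<close> outside \<open>W\<close> is
  settled by \<open>W\<close>, hence removed no later than any member of \<open>N\<close>. But
  \<open>i\<close> fails to precede some \<open>j\<close> in \<open>N\<close>, and a member
  \<open>j'\<close> strictly before \<open>j\<close> gives a contradiction.\<close>

lemma stage_order_wf:
  assumes X: "X \<in> Delta" and R: "stage_order X R"
  shows "wfP R"
  unfolding wfp_iff_ex_minimal
proof (intro allI impI)
  fix N :: "nat set" assume "N \<noteq> {}"
  then obtain z where z: "z \<in> N" by blast
  have trans: "R a b \<Longrightarrow> R a c \<or> R c b" for a b c using R unfolding stage_order_def by blast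
  have settled: "\<not> R k j \<longleftrightarrow> j \<in> settled X {i. R i k}" for j k
    using R unfolding stage_order_def by blast
  show "\<exists>m\<in>N. \<forall>y. R y m \<longrightarrow> y \<notin> N"
  proof (rule ccontr)
    assume "\<not> ?thesis"
    then have no_min: "\<exists>y\<in>N. R y m" if "m \<in> N" for m using that by blast
    define W where "W = {i. \<forall>j\<in>N. R i j}"
    \<comment> \<open>An interval whose interior meets \<open>uncovered W\<close> is not in
      \<open>W\<close>. If nothing is uncovered, everything is settled and \<open>z\<close> serves:
      \<open>z\<close> in \<open>W\<close> would give \<open>R z z\<close>, against the local
      condition at \<open>z\<close>.\<close>
    have "\<exists>i. i \<notin> W \<and> i \<in> settled X W"
    proof (cases "uncovered W = {}")
      case True
      have all: "i \<in> settled X W" for i using True by (simp add: settled_def homogeneous_def)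
      moreover have "z \<notin> W"
      proof
        assume "z \<in> W"
        then have "R z z" using z unfolding W_def by blast
        moreover have "W \<subseteq> {i. R i z}" using z unfolding W_def by blast
        then have "z \<in> settled X {i. R i z}" using all settled_mono by blast
        ultimately show False using settled by blast
      qed
      ultimately show ?thesis by blast
    next
      case False
      obtain i where i: "{lower i<..<upper i} \<inter> uncovered W \<noteq> {}"
          "homogeneous X ({lower i..upper i} \<inter> uncovered W)"
        using ex_homogeneous_interval[OF X closed_uncovered False] .
      then show ?thesis unfolding settled_def uncovered_def by blast
    qed
    then obtain i where i: "i \<notin> W" "i \<in> settled X W" by blast
    then obtain j where j: "j \<in> N" "\<not> R i j" unfolding W_def by blast
    obtain j' where j': "j' \<in> N" "R j' j" using no_min j(1) by blast
    have "W \<subseteq> {i. R i j'}" using j'(1) unfolding W_def by blast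
    then have "i \<in> settled X {i. R i j'}" using i(2) settled_mono by blast
    then have "\<not> R j' i" using settled by blast
    then show False using trans[OF j'(2)] j(2) by blast
  qed
qed

text \<open>Induction along \<open>R\<close> shows that \<open>k\<close> has the same predecessors
  in both orders. If \<open>R i k\<close>, the induction hypothesis feeds the same set to
  \<open>settled\<close>, so \<open>R i\<close> and \<open>S i\<close> agree; this gives one
  inclusion.\<close>

lemma stage_order_unique:
  assumes X: "X \<in> Delta" and R: "stage_order X R" and S: "stage_order X S"
  shows "R = S"
proof -
  have wR: "wfP R" and wS: "wfP S" using stage_order_wf X R S by blast+
  have tR: "R a b \<Longrightarrow> R a c \<or> R c b" and tS: "S a b \<Longrightarrow> S a c \<or> S c b" for a b c
    using R S unfolding stage_order_def by blast+
  have sR: "\<not> R k j \<longleftrightarrow> j \<in> settled X {i. R i k}" and sS: "\<not> S k j \<longleftrightarrow> j \<in> settled X {i. S i k}" for j k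
    using R S unfolding stage_order_def by blast+
  have transS: "S a c" if "S a b" "S b c" for a b c
    using that tS[OF that(1), of c] asympD[OF wfp_imp_asymp[OF wS], of b c] by blast
  have irreflR: "\<not> R k k" for k using asympD[OF wfp_imp_asymp[OF wR]] by blast
  have eq: "{i. R i k} = {i. S i k}" for k
  proof (induction k rule: wfp_induct_rule[OF wR])
    case (1 k)
    have same: "R i j \<longleftrightarrow> S i j" if "R i k" for i j
      using sR[of i j] sS[of i j] unfolding 1[OF that] by blast
    have sub: "R i k \<Longrightarrow> S i k" for i using same by blast
    have "R i k" if "S i k" for i
    proof (rule ccontr)
      assume "\<not> R i k"
      \<comment> \<open>For an \<open>S\<close>-least counterexample \<open>i\<close>, the
        \<open>S\<close>-predecessors of \<open>i\<close> are exactly the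
        \<open>R\<close>-predecessors of \<open>k\<close>. The local condition then equates
        \<open>S i k\<close> with \<open>R k k\<close>.\<close>
      obtain i where i: "S i k" "\<not> R i k" and min: "\<And>j. S j i \<Longrightarrow> S j k \<Longrightarrow> R j k"
        using wS[unfolded wfp_iff_ex_minimal, rule_format, of "{i. S i k \<and> \<not> R i k}"]
          \<open>S i k\<close> \<open>\<not> R i k\<close> by blast
      have "S j i \<longleftrightarrow> R j k" for j
      proof
        assume "S j i" then show "R j k" using min transS i(1) by blast
      next
        assume "R j k"
        then show "S j i" using tR[of j k i] i(2) same by blast
      qed
      then have "{j. S j i} = {j. R j k}" by blast
      then have "\<not> S i k \<longleftrightarrow> \<not> R k k" using sR sS by metis
      then show False using i(1) irreflR by blast
    qed
    with sub show ?case by blast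
  qed
  then show ?thesis by (blast intro!: ext)
qed

section \<open>Existence of the stage order\<close>

text \<open>This replaces iteration of \<open>settled X\<close> along the ordinals: unions serve as
  limit stages, the empty union as the start.\<close>

inductive_set tower :: "real set \<Rightarrow> nat set set" for X where
  Union: "\<forall>W\<in>M. W \<in> tower X \<Longrightarrow> \<Union>M \<in> tower X"
| settled: "W \<in> tower X \<Longrightarrow> settled X W \<in> tower X"

text \<open>This fails for arbitrary \<open>W\<close>: removing a single interval leaves its
  endpoints, which \<open>X\<close> may separate. Along the tower it follows from
  monotonicity.\<close>

lemma tower_subset_settled: "W \<in> tower X \<Longrightarrow> W \<subseteq> settled X W"
proof (induction rule: tower.induct)
  case (Union M)
  show ?case
  proof
    fix i assume "i \<in> \<Union>M"
    then obtain W where "W \<in> M" "i \<in> W" by blast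
    then have "i \<in> settled X W" using Union by blast
    then show "i \<in> settled X (\<Union>M)" using settled_mono[of W "\<Union>M"] \<open>W \<in> M\<close> by blast
  qed
qed (rule settled_mono)

text \<open>The classical Bourbaki--Witt argument: every \<open>U\<close> with the property assumed here is
  comparable with the whole tower, and by induction every \<open>U\<close> in the tower has it.\<close>

lemma tower_comparable:
  assumes U: "\<And>W. W \<in> tower X \<Longrightarrow> W \<subset> U \<Longrightarrow> settled X W \<subseteq> U" and "W \<in> tower X"
  shows "W \<subseteq> U \<or> settled X U \<subseteq> W"
  using assms(2)
proof (induction rule: tower.induct)
  case (Union M)
  then show ?case by blast
next
  case (settled W)
  then show ?case using U[of W] tower_subset_settled[of W X] by blast
qed

lemma tower_no_between:
  assumes "U \<in> tower X"
  shows "W \<in> tower X \<Longrightarrow> W \<subset> U \<Longrightarrow> settled X W \<subseteq> U"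
  using assms
proof (induction arbitrary: W rule: tower.induct)
  case (settled U)
  have "W \<subseteq> U \<or> settled X U \<subseteq> W"
    using settled by (intro tower_comparable) blast+
  then show ?case using settled tower_subset_settled[OF settled.hyps] by blast
next
  case (Union M)
  have comp: "W \<subseteq> U \<or> settled X U \<subseteq> W" if "U \<in> M" for U
    using that Union by (intro tower_comparable) blast+
  have inc: "U \<subseteq> settled X U" if "U \<in> M" for U
    using that Union by (intro tower_subset_settled) blast
  obtain U where U: "U \<in> M" "\<not> U \<subseteq> W"
    using Union by blast
  then have "W \<subset> U" using comp inc by blast
  then show ?case using U(1) Union by blast
qed

text \<open>The order is read off the tower: \<open>U\<close> is the largest stage omitting
  \<open>k\<close>. By comparability every stage containing \<open>k\<close> includes
  \<open>settled X U\<close>, which is one direction. For the other, if \<open>settled X U\<close>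
  still omitted \<open>k\<close>, nothing new would be settled although \<open>uncovered U\<close>
  is nonempty, contradicting \<open>ex_homogeneous_interval\<close>.\<close>

lemma ex_stage_order:
  assumes X: "X \<in> Delta"
  shows "\<exists>R. stage_order X R"
proof -
  define R where "R i k \<longleftrightarrow> (\<exists>W\<in>tower X. i \<in> W \<and> k \<notin> W)" for i k
  have "\<not> R k j \<longleftrightarrow> j \<in> settled X {i. R i k}" for j k
  proof -
    define U where "U = {i. R i k}"
    have U_eq: "U = \<Union>{W \<in> tower X. k \<notin> W}" unfolding U_def R_def by blast
    have U: "U \<in> tower X" unfolding U_eq by (rule tower.Union) blast
    have "k \<notin> U" unfolding U_eq by blast
    show ?thesis unfolding U_def[symmetric]
    proof
      assume j: "j \<in> settled X U"
      have "j \<in> W" if "W \<in> tower X" "k \<in> W" for W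
        using tower_comparable[OF tower_no_between[OF U] that(1)] that(2) \<open>k \<notin> U\<close> j by blast
      then show "\<not> R k j" unfolding R_def by blast
    next
      assume "\<not> R k j"
      show "j \<in> settled X U"
      proof (rule ccontr)
        assume j: "j \<notin> settled X U"
        have "settled X U \<in> tower X" using U by (rule tower.settled)
        with j \<open>\<not> R k j\<close> have k: "k \<notin> settled X U" unfolding R_def by blast
        with \<open>settled X U \<in> tower X\<close> have sub: "settled X U \<subseteq> U" unfolding U_eq by blast
        have "uncovered U \<noteq> {}" using k by (auto simp: settled_def homogeneous_def)
        then obtain i where "{lower i<..<upper i} \<inter> uncovered U \<noteq> {}"
            "homogeneous X ({lower i..upper i} \<inter> uncovered U)"
          using ex_homogeneous_interval[OF X closed_uncovered] by blast
        then show False using sub unfolding settled_def uncovered_def by blast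
      qed
    qed
  qed
  moreover have "R a b \<Longrightarrow> R a c \<or> R c b" for a b c unfolding R_def by blast
  ultimately show ?thesis unfolding stage_order_def by blast
qed

section \<open>The homogeneous closed pieces\<close>

text \<open>Among the rational open intervals around \<open>x\<close>, take an
  \<open>R\<close>-minimal one: no interval removed before it contains \<open>x\<close>.\<close>

lemma stage_order_cover:
  assumes X: "X \<in> Delta" and R: "stage_order X R"
  shows "\<exists>j. x \<in> {lower j..upper j} \<inter> uncovered {i. R i j}"
proof -
  obtain a b where "x - 1 < rat_at a" "rat_at a < x" "x < rat_at b" "rat_at b < x + 1"
    using ex_rat_at[of "x - 1" x] ex_rat_at[of x "x + 1"] by auto
  then obtain m where "x \<in> {lower m<..<upper m}"
    using ex_interval[of a b] by (metis greaterThanLessThan_iff)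
  then obtain j where "x \<in> {lower j<..<upper j}" "\<And>i. R i j \<Longrightarrow> x \<notin> {lower i<..<upper i}"
    using stage_order_wf[OF X R, unfolded wfp_iff_ex_minimal, rule_format,
        of "{m. x \<in> {lower m<..<upper m}}"] by blast
  then have "x \<in> {lower j..upper j} \<inter> uncovered {i. R i j}"
    unfolding uncovered_def by auto
  then show ?thesis by blast
qed

lemma stage_order_homogeneous:
  assumes X: "X \<in> Delta" and R: "stage_order X R"
  shows "homogeneous X ({lower j..upper j} \<inter> uncovered {i. R i j})"
proof -
  have "\<not> R j j" using asympD[OF wfp_imp_asymp[OF stage_order_wf[OF X R]]] by blast
  then show ?thesis using R unfolding stage_order_def settled_def by blast
qed

lemma Delta_closed_Int:
  assumes "X \<in> Delta" "closed C"
  shows "C \<inter> X \<in> Delta"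
proof -
  have "fsigma X" "gdelta X" using assms(1) unfolding Delta_def by auto
  obtain A :: "nat \<Rightarrow> real set" where A: "\<And>n. closed (A n)" "X = (\<Union>n. A n)"
    using \<open>fsigma X\<close> unfolding fsigma.simps by blast
  obtain B :: "nat \<Rightarrow> real set" where B: "\<And>n. open (B n)" "X = (\<Inter>n. B n)"
    using \<open>gdelta X\<close> unfolding gdelta.simps by blast
  have "fsigma (\<Union>n. C \<inter> A n)"
    using A(1) assms(2) by (intro fsigma.intros closed_Int)
  then have "fsigma (C \<inter> X)" unfolding A(2) by (simp only: Int_UN_distrib)
  moreover have "gdelta (C \<inter> X)"
  proof -
    \<comment> \<open>\<open>C\<close> is closed, hence the intersection of its open neighbourhoods
      of radius \<open>1 / (n + 1)\<close>; cutting these down by the \<open>B n\<close> presents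
      \<open>C \<inter> X\<close> as a G-delta set.\<close>
    define U where "U n = (\<Union>y\<in>C. ball y (1 / real (Suc n))) \<inter> B n" for n
    have U_C: "x \<in> C" if "\<And>n. x \<in> U n" for x
    proof -
      have "\<exists>y\<in>C. dist y x < e" if "e > 0" for e
      proof -
        obtain n where n: "1 / real (Suc n) < e"
          using reals_Archimedean[OF \<open>e > 0\<close>] by (auto simp: field_simps)
        obtain y where "y \<in> C" "dist y x < 1 / real (Suc n)"
          using \<open>\<And>n. x \<in> U n\<close>[of n] unfolding U_def by auto
        then show ?thesis using n by (intro bexI[of _ y]) auto
      qed
      then have "x \<in> closure C" unfolding closure_approachable by blast
      then show ?thesis using assms(2) by simp
    qed
    have C_U: "C \<inter> X \<subseteq> U n" for n
    proof -
      have "C \<subseteq> (\<Union>y\<in>C. ball y (1 / real (Suc n)))" by force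
      then show ?thesis using B(2) unfolding U_def by blast
    qed
    have U_B: "U n \<subseteq> B n" for n unfolding U_def by blast
    have "C \<inter> X = (\<Inter>n. U n)"
    proof
      show "(\<Inter>n. U n) \<subseteq> C \<inter> X"
      proof
        fix x assume "x \<in> (\<Inter>n. U n)"
        then have x: "x \<in> U n" for n by simp
        then have "x \<in> X" using U_B unfolding B(2) by blast
        then show "x \<in> C \<inter> X" using U_C[OF x] by simp
      qed
    qed (use C_U in blast)
    moreover have "gdelta (\<Inter>n. U n)"
      unfolding U_def by (intro gdelta.intros open_Int open_UN ballI open_ball B(1))
    ultimately show ?thesis by simp
  qed
  ultimately show ?thesis unfolding Delta_def by blast
qed

lemma finite_Delta: "finite S \<Longrightarrow> S \<in> Delta"
proof -
  assume "finite S"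
  have "gdelta (\<Inter>n::nat. UNIV :: real set)"
    by (intro gdelta.intros) simp
  then have "UNIV \<in> Delta" unfolding Delta_def by simp
  from Delta_closed_Int[OF this finite_imp_closed[OF \<open>finite S\<close>]] show ?thesis by simp
qed

section \<open>Rational numbers, real numbers and binary digits\<close>

lemma decidable_let:
  assumes "computable k l t" and "decidable (Suc k) l (\<lambda>F v w. P F (v 0) (\<lambda>i. v (Suc i)) w)"
  shows "decidable k l (\<lambda>F v w. P F (t F v w) v w)"
  using assms unfolding decidable_def by (rule computable_let)

lemma computable_div2:
  assumes "computable k l t" shows "computable k l (\<lambda>F v w. t F v w div 2)"
proof -
  have "rec_nat 0 (\<lambda>x y. if n = x + x \<or> n = Suc (x + x) then x else y) (Suc n) = n div 2" for n
    by (rule rec_nat_search) presburger+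
  moreover have "computable k l (\<lambda>F v w. rec_nat 0
      (\<lambda>x y. if t F v w = x + x \<or> t F v w = Suc (x + x) then x else y) (Suc (t F v w)))"
    by (rule computable_rec computable_if decidable_disj decidable_eq computable_add
        computable_Suc computable_const computable_var assms | rule computable_shift | simp)+
  ultimately show ?thesis by (simp only:)
qed

lemma decidable_even:
  assumes "computable k l t" shows "decidable k l (\<lambda>F v w. even (t F v w))"
proof -
  have "even n \<longleftrightarrow> n div 2 + n div 2 = n" for n :: nat by presburger
  then show ?thesis using decidable_eq[OF computable_add[OF computable_div2 computable_div2]
      assms, OF assms assms] by (simp only:)
qed

section \<open>Comparing coded rationals\<close>

text \<open>Splitting integers into differences of naturals reduces the comparison of rationals to
  arithmetic in \<open>nat\<close>.\<close>

definition int_pos :: "nat \<Rightarrow> nat" where "int_pos z = (if even z then z div 2 else 0)"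
definition int_neg :: "nat \<Rightarrow> nat" where "int_neg z = (if even z then 0 else Suc (z div 2))"

lemma int_decode_eq_diff: "int_decode z = int (int_pos z) - int (int_neg z)"
  by (simp add: int_decode_def sum_decode_def int_pos_def int_neg_def)

lemma computable_int_pos: "computable k l t \<Longrightarrow> computable k l (\<lambda>F v w. int_pos (t F v w))"
  unfolding int_pos_def by (intro computable_if decidable_even computable_div2 computable_const)

lemma computable_int_neg: "computable k l t \<Longrightarrow> computable k l (\<lambda>F v w. int_neg (t F v w))"
  unfolding int_neg_def by (intro computable_if decidable_even computable_div2 computable_const
      computable_Suc)

text \<open>Extending a fraction \<open>i / j\<close> by \<open>j\<close> makes the denominator nonnegative; the extra summand
  takes care of \<open>j = 0\<close>, where the coded rational number is \<open>0\<close>.\<close>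

definition num_pos :: "nat \<Rightarrow> nat \<Rightarrow> nat" where
  "num_pos i j = int_pos i * int_pos j + int_neg i * int_neg j"
definition num_neg :: "nat \<Rightarrow> nat \<Rightarrow> nat" where
  "num_neg i j = int_pos i * int_neg j + int_neg i * int_pos j"
definition denom :: "nat \<Rightarrow> nat" where
  "denom j = (int_pos j + int_neg j) * (int_pos j + int_neg j) + (if j = 0 then 1 else 0)"

lemma rat_at_eq:
  assumes "prod_decode a = (i, j)"
  shows "rat_at a = (real (num_pos i j) - real (num_neg i j)) / real (denom j)" and "denom j > 0"
proof -
  have prod0: "int_pos z * int_neg z = 0" for z by (simp add: int_pos_def int_neg_def)
  have j0: "int_decode j = 0 \<longleftrightarrow> j = 0"
    by (auto simp: int_decode_eq_diff int_pos_def int_neg_def split: if_splits elim!: oddE evenE)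
  have j1: "int_pos j = 0 \<and> int_neg j = 0 \<longleftrightarrow> j = 0"
    by (auto simp: int_pos_def int_neg_def elim!: evenE intro: odd_pos)
  show "denom j > 0" using j1 by (auto simp: denom_def)
  have num: "real (num_pos i j) - real (num_neg i j) = of_int (int_decode i) * of_int (int_decode j)"
    by (simp add: int_decode_eq_diff num_pos_def num_neg_def algebra_simps)
  have "real (denom j) = of_int (int_decode j) * of_int (int_decode j)" if "j \<noteq> 0"
  proof -
    have "real (int_pos j) * real (int_neg j) = 0" using prod0[of j] by (metis of_nat_0 of_nat_mult)
    then show ?thesis using that by (simp add: denom_def int_decode_eq_diff algebra_simps)
  qed
  moreover have "rat_at a = of_int (int_decode i) / of_int (int_decode j)"
  proof (cases "int_decode j = 0")
    case True
    then show ?thesis by (simp add: rat_at_def nat_to_rat_surj_def assms eq_rat(2)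
        rat_number_collapse)
  next
    case False
    then show ?thesis by (simp add: rat_at_def nat_to_rat_surj_def assms of_rat_rat)
  qed
  ultimately show "rat_at a = (real (num_pos i j) - real (num_neg i j)) / real (denom j)"
    using num j0 by (cases "j = 0") simp_all
qed

lemma rat_at_less_iff:
  assumes "prod_decode a = (i, j)" "prod_decode b = (i', j')"
  shows "rat_at a < rat_at b \<longleftrightarrow>
    num_pos i j * denom j' + num_neg i' j' * denom j < num_pos i' j' * denom j + num_neg i j * denom j'"
proof -
  have "rat_at a < rat_at b \<longleftrightarrow>
    (real (num_pos i j) - real (num_neg i j)) * real (denom j') <
    (real (num_pos i' j') - real (num_neg i' j')) * real (denom j)"
    unfolding rat_at_eq(1)[OF assms(1)] rat_at_eq(1)[OF assms(2)]
    using rat_at_eq(2)[OF assms(1)] rat_at_eq(2)[OF assms(2)] by (simp add: divide_simps)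
  also have "\<dots> \<longleftrightarrow> real (num_pos i j * denom j' + num_neg i' j' * denom j)
      < real (num_pos i' j' * denom j + num_neg i j * denom j')"
    by (simp add: algebra_simps)
  finally show ?thesis by (simp only: of_nat_less_iff)
qed

lemma decidable_rat_at_less:
  assumes "computable k l s" "computable k l t"
  shows "decidable k l (\<lambda>F v w. rat_at (s F v w) < rat_at (t F v w))"
proof -
  have num: "computable k l (\<lambda>F v w. num_pos (s F v w) (t F v w))"
    "computable k l (\<lambda>F v w. num_neg (s F v w) (t F v w))"
    if "computable k l s" "computable k l t" for s t
    unfolding num_pos_def num_neg_def
    by (intro computable_add computable_mult computable_int_pos computable_int_neg that)+
  have denom: "computable k l (\<lambda>F v w. denom (t F v w))" if "computable k l t" for t
    unfolding denom_def
    by (intro computable_add computable_mult computable_int_pos computable_int_neg computable_if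
        decidable_eq computable_const that)
  show ?thesis
    unfolding rat_at_less_iff[OF prod.collapse[symmetric] prod.collapse[symmetric]]
    by (intro decidable_less computable_add computable_mult num denom computable_fst_prod_decode
        computable_snd_prod_decode assms)
qed

section \<open>Comparing a coded real with a rational\<close>

text \<open>For any sequence this says that its lower limit exceeds \<open>rat_at a\<close>. Only
  number quantifiers occur, so \<open>exists2\<close> decides it.\<close>

definition below :: "nat \<Rightarrow> type1 \<Rightarrow> bool" where
  "below a f \<longleftrightarrow> (\<exists>c n. rat_at a < rat_at c \<and> (\<forall>m. n \<le> m \<longrightarrow> \<not> rat_at (f m) < rat_at c))"

definition above :: "nat \<Rightarrow> type1 \<Rightarrow> bool" where
  "above a f \<longleftrightarrow> (\<exists>c n. rat_at c < rat_at a \<and> (\<forall>m. n \<le> m \<longrightarrow> \<not> rat_at c < rat_at (f m)))"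

lemma codes_realD: "codes_real f x \<Longrightarrow> (\<lambda>n. rat_at (f n)) \<longlonglongrightarrow> x"
  unfolding codes_real_def rat_at_def by blast

lemma below_iff:
  assumes "codes_real f x" shows "below a f \<longleftrightarrow> rat_at a < x"
proof
  assume "below a f"
  then obtain c n where c: "rat_at a < rat_at c" "\<forall>m\<ge>n. rat_at c \<le> rat_at (f m)"
    unfolding below_def by (auto simp: not_less)
  have "rat_at c \<le> x" using c(2) by (intro LIMSEQ_le_const[OF codes_realD[OF assms]]) blast
  then show "rat_at a < x" using c(1) by simp
next
  assume "rat_at a < x"
  then obtain c where c: "rat_at a < rat_at c" "rat_at c < x" using ex_rat_at by blast
  obtain n where "\<forall>m\<ge>n. rat_at c < rat_at (f m)"
    using order_tendstoD(1)[OF codes_realD[OF assms] c(2)] unfolding eventually_sequentially by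
        blast
  then show "below a f" using c(1) unfolding below_def by (meson less_asym)
qed

lemma above_iff:
  assumes "codes_real f x" shows "above a f \<longleftrightarrow> x < rat_at a"
proof
  assume "above a f"
  then obtain c n where c: "rat_at c < rat_at a" "\<forall>m\<ge>n. rat_at (f m) \<le> rat_at c"
    unfolding above_def by (auto simp: not_less)
  have "x \<le> rat_at c" using c(2) by (intro LIMSEQ_le_const2[OF codes_realD[OF assms]]) blast
  then show "x < rat_at a" using c(1) by simp
next
  assume "x < rat_at a"
  then obtain c where c: "x < rat_at c" "rat_at c < rat_at a" using ex_rat_at by blast
  obtain n where "\<forall>m\<ge>n. rat_at (f m) < rat_at c"
    using order_tendstoD(2)[OF codes_realD[OF assms] c(1)] unfolding eventually_sequentially by
        blast
  then show "above a f" using c(2) unfolding above_def by (meson less_asym)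
qed

lemma decidable_below:
  assumes "i < l" "computable k l t" shows "decidable k l (\<lambda>F v w. below (t F v w) (w i))"
  unfolding below_def using assms(1)
  by - (rule decidable_ex decidable_all decidable_conj decidable_imp decidable_not
      decidable_rat_at_less decidable_le computable_app computable_var assms(2)
      | rule computable_shift | simp)+

lemma decidable_above:
  assumes "i < l" "computable k l t" shows "decidable k l (\<lambda>F v w. above (t F v w) (w i))"
  unfolding above_def using assms(1)
  by - (rule decidable_ex decidable_all decidable_conj decidable_imp decidable_not
      decidable_rat_at_less decidable_le computable_app computable_var assms(2)
      | rule computable_shift | simp)+

section \<open>Binary digits\<close>

text \<open>A code of \<open>p / 2 ^ Suc n\<close>, as a nonnegative integer is coded by its double.
  Denominators start at \<open>2\<close>, so \<open>dyadic 2 0\<close> codes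
  \<open>1\<close>.\<close>

definition dyadic :: "nat \<Rightarrow> nat \<Rightarrow> nat" where
  "dyadic p n = prod_encode (p + p, 2 ^ n * 4)"

lemma rat_at_dyadic: "rat_at (dyadic p n) = real p / 2 ^ Suc n"
proof -
  have "int_decode (p + p) = int p" "int_decode (2 ^ n * 4) = int (2 ^ Suc n)"
    by (simp_all add: int_decode_def sum_decode_def)
  then show ?thesis
    unfolding rat_at_def nat_to_rat_surj_def dyadic_def by (simp add: of_rat_rat)
qed

lemma computable_dyadic:
  assumes "computable k l s" "computable k l t"
  shows "computable k l (\<lambda>F v w. dyadic (s F v w) (t F v w))"
  unfolding dyadic_def by (intro computable_prod_encode computable_add computable_mult
      computable_pow2 computable_const assms)

text \<open>This is the binary digit of weight \<open>1 / 2 ^ Suc n\<close>: the integer part of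
  \<open>2 ^ Suc n * x\<close> is an odd number \<open>2 * p + 1\<close>.\<close>

definition digit :: "nat \<Rightarrow> type1 \<Rightarrow> bool" where
  "digit n f \<longleftrightarrow> (\<exists>p. \<not> above (dyadic (Suc (p + p)) n) f \<and> above (dyadic (Suc (Suc (p + p))) n) f)"

lemma decidable_digit:
  assumes "i < l" "computable k l t" shows "decidable k l (\<lambda>F v w. digit (t F v w) (w i))"
  unfolding digit_def using assms(1)
  by - (rule decidable_ex decidable_conj decidable_not decidable_above computable_dyadic
      computable_Suc computable_add computable_var assms(2)
      | rule computable_shift | simp)+

definition in_unit :: "type1 \<Rightarrow> bool" where
  "in_unit f \<longleftrightarrow> \<not> above (dyadic 0 0) f \<and> above (dyadic 2 0) f"

lemma decidable_in_unit: "i < l \<Longrightarrow> decidable k l (\<lambda>F v w. in_unit (w i))"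
  unfolding in_unit_def by (intro decidable_conj decidable_not decidable_above computable_const)

lemma in_unit_iff: "codes_real f x \<Longrightarrow> in_unit f \<longleftrightarrow> 0 \<le> x \<and> x < 1"
  by (simp add: in_unit_def above_iff rat_at_dyadic not_less)

lemma digit_iff:
  assumes "codes_real f x" "0 \<le> x"
  shows "digit n f \<longleftrightarrow> odd \<lfloor>2 ^ Suc n * x\<rfloor>"
proof -
  have "digit n f \<longleftrightarrow> (\<exists>p::nat. 2 * real p + 1 \<le> 2 ^ Suc n * x \<and> 2 ^ Suc n * x < 2 * real p + 2)"
    unfolding digit_def above_iff[OF assms(1)] rat_at_dyadic
    by (simp add: field_simps not_less)
  also have "\<dots> \<longleftrightarrow> (\<exists>p::nat. \<lfloor>2 ^ Suc n * x\<rfloor> = 2 * int p + 1)"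
    by (simp add: floor_eq_iff algebra_simps)
  also have "\<dots> \<longleftrightarrow> odd \<lfloor>2 ^ Suc n * x\<rfloor>"
  proof
    assume "odd \<lfloor>2 ^ Suc n * x\<rfloor>"
    then obtain q where q: "\<lfloor>2 ^ Suc n * x\<rfloor> = 2 * q + 1" by (rule oddE)
    have "0 \<le> 2 * q + 1" unfolding q[symmetric] using assms(2) by simp
    then have "0 \<le> q" by simp
    then show "\<exists>p::nat. \<lfloor>2 ^ Suc n * x\<rfloor> = 2 * int p + 1" using q by (metis nat_0_le)
  qed auto
  finally show ?thesis .
qed

lemma floor_double: "\<lfloor>2 * z\<rfloor> = 2 * \<lfloor>z\<rfloor> + (if odd \<lfloor>2 * z\<rfloor> then 1 else 0)" for z :: real
proof -
  have "2 * \<lfloor>z\<rfloor> \<le> \<lfloor>2 * z\<rfloor>" "\<lfloor>2 * z\<rfloor> \<le> 2 * \<lfloor>z\<rfloor> + 1" by linarith+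
  then show ?thesis by presburger
qed

text \<open>By repeated doubling the digits determine the floor at every scale \<open>2 ^ n\<close>,
  and equal floors leave a distance of at most \<open>1 / 2 ^ n\<close>.\<close>

lemma binary_digits_unique:
  assumes "0 \<le> x" "x < 1" "0 \<le> y" "y < 1"
    and digits: "\<And>n. odd \<lfloor>2 ^ Suc n * x\<rfloor> \<longleftrightarrow> odd \<lfloor>2 ^ Suc n * y\<rfloor>"
  shows "x = (y :: real)"
proof -
  have eq: "\<lfloor>2 ^ n * x\<rfloor> = \<lfloor>2 ^ n * y\<rfloor>" for n
  proof (induction n)
    case 0
    have "\<lfloor>x\<rfloor> = 0" "\<lfloor>y\<rfloor> = 0" using assms(1-4) by (simp_all add: floor_eq_iff)
    then show ?case by simp
  next
    case (Suc n)
    then show ?case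
      using floor_double[of "2 ^ n * x"] floor_double[of "2 ^ n * y"] digits[of n]
      by (simp add: mult.assoc)
  qed
  have "\<bar>x - y\<bar> \<le> (1 / 2) ^ n" for n
  proof -
    have "\<bar>2 ^ n * x - 2 ^ n * y\<bar> \<le> 1" using eq[of n] by linarith
    then have "2 ^ n * \<bar>x - y\<bar> \<le> 1" by (simp add: abs_mult right_diff_distrib[symmetric])
    then show ?thesis by (simp add: field_simps)
  qed
  moreover have "(\<lambda>n. (1 / 2 :: real) ^ n) \<longlonglongrightarrow> 0" by (rule LIMSEQ_realpow_zero) auto
  ultimately have "\<bar>x - y\<bar> \<le> 0" by (intro LIMSEQ_le_const) auto
  then show ?thesis by simp
qed

text \<open>The digits must not end in a constant sequence of ones.\<close>

lemma binary_digits_exist: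
  assumes "infinite {n. \<not> P n}"
  obtains x :: real where "0 \<le> x" "x < 1" "\<And>n. odd \<lfloor>2 ^ Suc n * x\<rfloor> \<longleftrightarrow> P n"
proof -
  define N :: "nat \<Rightarrow> nat" where "N = rec_nat 0 (\<lambda>n a. 2 * a + (if P n then 1 else 0))"
  have N: "N 0 = 0" "N (Suc n) = 2 * N n + (if P n then 1 else 0)" for n by (simp_all add: N_def)
  define lo hi :: "nat \<Rightarrow> real" where "lo n = N n / 2 ^ n" and "hi n = (real (N n) + 1) / 2 ^ n" for n
  have lo_Suc: "lo n \<le> lo (Suc n)" and hi_Suc: "hi (Suc n) \<le> hi n" for n
    by (simp_all add: lo_def hi_def N field_simps)
  have strict: "hi (Suc n) < hi n" if "\<not> P n" for n
    using that by (simp add: hi_def N field_simps)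
  have incseq: "incseq lo" by (intro incseq_SucI lo_Suc)
  have decseq: "decseq hi" by (intro decseq_SucI hi_Suc)
  have lo_hi: "lo n < hi n" for n by (simp add: lo_def hi_def divide_strict_right_mono)
  have lo_hi': "lo m \<le> hi n" for m n
  proof -
    have "lo m \<le> lo (max m n)" using incseq by (simp add: incseq_def)
    also have "\<dots> \<le> hi (max m n)" using lo_hi less_imp_le by blast
    also have "\<dots> \<le> hi n" using decseq by (simp add: decseq_def)
    finally show ?thesis .
  qed
  define x where "x = (SUP n. lo n)"
  have bdd: "bdd_above (range lo)" using lo_hi' by (auto intro!: bdd_aboveI[of _ "hi 0"])
  have lo_x: "lo n \<le> x" for n unfolding x_def by (rule cSUP_upper[OF _ bdd]) simp
  have x_le_hi: "x \<le> hi n" for n unfolding x_def by (rule cSUP_least) (use lo_hi' in auto)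
  \<comment> \<open>Each zero digit lowers \<open>hi\<close> strictly, and one occurs beyond every
    position. So \<open>x\<close> stays below \<open>hi n\<close>, and the floor is exactly
    \<open>N n\<close>.\<close>
  have x_hi: "x < hi n" for n
  proof -
    obtain m where m: "n < m" "\<not> P m" using assms unfolding infinite_nat_iff_unbounded by blast
    have "x \<le> hi (Suc m)" by (rule x_le_hi)
    also have "\<dots> < hi m" by (rule strict[OF m(2)])
    also have "\<dots> \<le> hi n" using decseq m(1) by (simp add: decseq_def)
    finally show ?thesis .
  qed
  have floor: "\<lfloor>2 ^ n * x\<rfloor> = int (N n)" for n
    using lo_x[of n] x_hi[of n] by (simp add: floor_eq_iff lo_def hi_def field_simps)
  show ?thesis
  proof
    show "0 \<le> x" using lo_x[of 0] by (simp add: lo_def N)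
    show "x < 1" using x_hi[of 0] by (simp add: hi_def N)
    show "odd \<lfloor>2 ^ Suc n * x\<rfloor> \<longleftrightarrow> P n" for n unfolding floor N by simp
  qed
qed

section \<open>Computing the code\<close>

definition in_interval :: "nat \<Rightarrow> type1 \<Rightarrow> bool" where
  "in_interval j g \<longleftrightarrow> \<not> above (fst (prod_decode j)) g \<and> \<not> below (snd (prod_decode j)) g"

definition avoids :: "(nat \<Rightarrow> nat \<Rightarrow> bool) \<Rightarrow> nat \<Rightarrow> type1 \<Rightarrow> bool" where
  "avoids R k g \<longleftrightarrow>
     (\<forall>i. R i k \<longrightarrow> \<not> (below (fst (prod_decode i)) g \<and> above (snd (prod_decode i)) g))"

definition meets :: "bool \<Rightarrow> type2 \<Rightarrow> (nat \<Rightarrow> nat \<Rightarrow> bool) \<Rightarrow> nat \<Rightarrow> nat \<Rightarrow> bool" where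
  "meets b F R j k \<longleftrightarrow> (\<exists>g y. codes_real g y \<and> ((F g = 1 \<longleftrightarrow> b) \<and> in_interval j g \<and> avoids R k g))"

lemma region_iff:
  assumes "codes_real g y"
  shows "in_interval j g \<and> avoids R k g \<longleftrightarrow> y \<in> {lower j..upper j} \<inter> uncovered {i. R i k}"
  by (auto simp: in_interval_def avoids_def uncovered_def below_iff[OF assms] above_iff[OF assms]
      not_less lower_def upper_def)

lemma closed_region: "closed ({lower j..upper j} \<inter> uncovered {i. R i k})"
  by (intro closed_Int closed_atLeastAtMost closed_uncovered)

lemma meets_iff:
  assumes "char_fun F X"
  shows "meets b F R j k \<longleftrightarrow>
    \<not> {lower j..upper j} \<inter> uncovered {i. R i k} \<subseteq> (if b then - X else X)"
proof -
  have F: "F g = 1 \<longleftrightarrow> y \<in> X" if "codes_real g y" for g y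
    using assms that unfolding char_fun_def by simp
  have "meets b F R j k \<longleftrightarrow> (\<exists>g y. codes_real g y \<and>
      (y \<in> X \<longleftrightarrow> b) \<and> y \<in> {lower j..upper j} \<inter> uncovered {i. R i k})"
    unfolding meets_def using F region_iff by blast
  also have "\<dots> \<longleftrightarrow> (\<exists>y. (y \<in> X \<longleftrightarrow> b) \<and> y \<in> {lower j..upper j} \<inter> uncovered {i. R i k})"
    using ex_codes_real by blast
  also have "\<dots> \<longleftrightarrow> \<not> {lower j..upper j} \<inter> uncovered {i. R i k} \<subseteq> (if b then - X else X)"
    by (cases b) auto
  finally show ?thesis .
qed

text \<open>The region is closed whatever the relation is, so its intersection with \<open>X\<close>
  or \<open>- X\<close> is in \<open>Delta\<close>. This generality matters because the relation
  will be read from the digits of an arbitrary real.\<close>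

lemma decidable_meets:
  assumes "i < k" "j < k"
    and R: "decidable (Suc k) (Suc l) (\<lambda>F v w. R F (\<lambda>i. w (Suc i)) (v 0) (v (Suc j)))"
  shows "decidable k l (\<lambda>F v w. meets b F (R F w) (v i) (v j))"
  unfolding meets_def
proof (rule decidable_Omega)
  have "decidable k (Suc l) (\<lambda>F v w. avoids (R F (\<lambda>i. w (Suc i))) (v j) (w 0))"
    unfolding avoids_def
    by (rule decidable_all decidable_imp R decidable_not decidable_conj decidable_above
        decidable_below computable_fst_prod_decode
        computable_snd_prod_decode computable_var | simp)+
  moreover have "decidable k (Suc l) (\<lambda>F v w. in_interval (v i) (w 0))"
    unfolding in_interval_def
    by (intro decidable_not decidable_conj decidable_above decidable_below
        computable_fst_prod_decode
        computable_snd_prod_decode computable_var zero_less_Suc assms(1))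
  moreover have "decidable k (Suc l) (\<lambda>F v w. (F (w 0) = 1) \<longleftrightarrow> b)"
    by (cases b; simp only: simp_thms) (intro decidable_not decidable_eq computable_oracle
        computable_const zero_less_Suc)+
  ultimately show "decidable k (Suc l) (\<lambda>F v w. (F (w 0) = 1 \<longleftrightarrow> b) \<and> in_interval (v i) (w 0) \<and>
      avoids (R F (\<lambda>i. w (Suc i))) (v j) (w 0))"
    by (intro decidable_conj)
next
  fix F v w assume "presents_Delta F"
  then obtain X where X: "X \<in> Delta" "char_fun F X" unfolding presents_Delta_def by blast
  define C where "C = {lower (v i)..upper (v i)} \<inter> uncovered {n. R F w n (v j)}"
  have "C \<inter> (if b then X else - X) \<in> Delta"
    unfolding C_def using X(1) by (intro Delta_closed_Int closed_region) (simp add: Delta_Compl)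
  moreover have "((F g = 1 \<longleftrightarrow> b) \<and> in_interval (v i) g \<and> avoids (R F w) (v j) g)
      = (y \<in> C \<inter> (if b then X else - X))" if "codes_real g y" for g y
  proof -
    have "F g = 1 \<longleftrightarrow> y \<in> X" using X(2) that unfolding char_fun_def by simp
    then show ?thesis unfolding region_iff[OF that] C_def by auto
  qed
  ultimately show "\<exists>Y\<in>Delta. \<forall>g y. codes_real g y \<longrightarrow>
      ((F g = 1 \<longleftrightarrow> b) \<and> in_interval (v i) g \<and> avoids (R F w) (v j) g) = (y \<in> Y)"
    by blast
qed

definition presents_stage_order :: "type2 \<Rightarrow> (nat \<Rightarrow> nat \<Rightarrow> bool) \<Rightarrow> bool" where
  "presents_stage_order F R \<longleftrightarrow> (\<forall>a b c. R a b \<longrightarrow> R a c \<or> R c b) \<and>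
     (\<forall>j k. \<not> R k j \<longleftrightarrow> \<not> meets False F R j k \<or> \<not> meets True F R j k)"

lemma presents_stage_order_iff:
  "char_fun F X \<Longrightarrow> presents_stage_order F R \<longleftrightarrow> stage_order X R"
  unfolding presents_stage_order_def stage_order_def settled_def homogeneous_def
  by (simp add: meets_iff)

definition digit_rel :: "type1 \<Rightarrow> nat \<Rightarrow> nat \<Rightarrow> bool" where
  "digit_rel f i k \<longleftrightarrow> digit (prod_encode (i, k)) f"

lemma decidable_digit_rel:
  "n < l \<Longrightarrow> computable k l s \<Longrightarrow> computable k l t \<Longrightarrow> decidable k l (\<lambda>F v w. digit_rel (w n) (s F v w) (t F v w))"
  unfolding digit_rel_def by (intro decidable_digit computable_prod_encode)

lemma decidable_presents_stage_order:
  assumes "n < l"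
  shows "decidable k l (\<lambda>F v w. presents_stage_order F (digit_rel (w n)))"
proof -
  have "decidable k l (\<lambda>F v w. meets b F (digit_rel (w n)) (v i) (v j))" if "i < k" "j < k" for b i j k
    by (rule decidable_meets[where R = "\<lambda>F w. digit_rel (w n)"])
       (intro that decidable_digit_rel computable_var Suc_mono assms zero_less_Suc)+
  note meets = this
  show ?thesis
    unfolding presents_stage_order_def
    by (rule decidable_conj decidable_all decidable_imp decidable_disj decidable_iff decidable_not
        decidable_digit_rel computable_var assms meets | simp)+
qed

section \<open>Extracting the stage order by \<open>Omega_Delta\<close>\<close>

definition stage_less :: "type2 \<Rightarrow> nat \<Rightarrow> nat \<Rightarrow> bool" where
  "stage_less F i k \<longleftrightarrow> (\<exists>f x. codes_real f x \<and>
     (in_unit f \<and> presents_stage_order F (digit_rel f) \<and> digit_rel f i k))"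

lemma digit_rel_iff:
  assumes "codes_real f x" "0 \<le> x"
  shows "digit_rel f = (\<lambda>i k. odd \<lfloor>2 ^ Suc (prod_encode (i, k)) * x\<rfloor>)"
  unfolding digit_rel_def digit_iff[OF assms] by simp

text \<open>The set submitted to \<open>Omega_Delta\<close> has at most one point: the stage order
  is unique and determines all digits. Being finite, it is in \<open>Delta\<close>.\<close>

lemma decidable_stage_less:
  assumes "i < k" "j < k"
  shows "decidable k l (\<lambda>F v w. stage_less F (v i) (v j))"
  unfolding stage_less_def
proof (rule decidable_Omega)
  show "decidable k (Suc l) (\<lambda>F v w. in_unit (w 0) \<and> presents_stage_order F (digit_rel (w 0)) \<and>
      digit_rel (w 0) (v i) (v j))"
    by (intro decidable_conj decidable_in_unit decidable_presents_stage_order decidable_digit_rel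
        computable_var assms zero_less_Suc)
next
  fix F and v :: "nat \<Rightarrow> nat" and w :: "nat \<Rightarrow> type1" assume "presents_Delta F"
  then obtain X where X: "X \<in> Delta" "char_fun F X" unfolding presents_Delta_def by blast
  define E where "E x = (\<lambda>i k. odd \<lfloor>2 ^ Suc (prod_encode (i, k)) * x\<rfloor>)" for x :: real
  define Y where "Y = {x. 0 \<le> x \<and> x < 1 \<and> stage_order X (E x) \<and> E x (v i) (v j)}"
  have "x = y" if "x \<in> Y" "y \<in> Y" for x y
  proof (rule binary_digits_unique)
    have "E x = E y" using stage_order_unique[OF X(1)] that unfolding Y_def by blast
    then have "odd \<lfloor>2 ^ Suc (prod_encode (prod_decode n)) * x\<rfloor> =
        odd \<lfloor>2 ^ Suc (prod_encode (prod_decode n)) * y\<rfloor>" for n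
      unfolding E_def by (metis prod.collapse)
    then show "odd \<lfloor>2 ^ Suc n * x\<rfloor> = odd \<lfloor>2 ^ Suc n * y\<rfloor>" for n by simp
  qed (use that in \<open>auto simp: Y_def\<close>)
  then have "Y \<subseteq> {x}" if "x \<in> Y" for x using that by blast
  then have "finite Y" by (metis ex_in_conv finite.emptyI finite.insertI finite_subset)
  moreover have "(in_unit f \<and> presents_stage_order F (digit_rel f) \<and> digit_rel f (v i) (v j))
      = (x \<in> Y)" if "codes_real f x" for f x
  \<comment> \<open>\<open>digit_iff\<close> covers nonnegative reals only; outside the unit
    interval both sides are false.\<close>
  proof (cases "0 \<le> x \<and> x < 1")
    case True
    then show ?thesis
      unfolding in_unit_iff[OF that] presents_stage_order_iff[OF X(2)] Y_def E_def
      using digit_rel_iff[OF that] by simp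
  next
    case False
    then show ?thesis unfolding in_unit_iff[OF that] Y_def by blast
  qed
  ultimately show "\<exists>Y\<in>Delta. \<forall>f x. codes_real f x \<longrightarrow>
      (in_unit f \<and> presents_stage_order F (digit_rel f) \<and> digit_rel f (v i) (v j)) = (x \<in> Y)"
    using finite_Delta by blast
qed

lemma stage_less_eq:
  assumes F: "char_fun F X" and X: "X \<in> Delta" and R: "stage_order X R"
  shows "stage_less F = R"
proof (intro ext iffI)
  fix i k assume "stage_less F i k"
  then show "R i k"
    unfolding stage_less_def presents_stage_order_iff[OF F] using stage_order_unique[OF X _ R] by blast
next
  fix i k assume "R i k"
  have "\<not> R n n" for n using asympD[OF wfp_imp_asymp[OF stage_order_wf[OF X R]]] by blast
  \<comment> \<open>Irreflexivity puts a zero at every diagonal position, so the expansion has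
    infinitely many zeros, as \<open>binary_digits_exist\<close> requires.\<close>
  then have "range (\<lambda>n. prod_encode (n, n)) \<subseteq> {n. \<not> case_prod R (prod_decode n)}" by auto
  moreover have "infinite (range (\<lambda>n. prod_encode (n, n)))"
    by (rule range_inj_infinite) (simp add: inj_def)
  ultimately have "infinite {n. \<not> case_prod R (prod_decode n)}" by (metis infinite_super)
  then obtain x :: real where x: "0 \<le> x" "x < 1"
      "\<And>n. odd \<lfloor>2 ^ Suc n * x\<rfloor> \<longleftrightarrow> case_prod R (prod_decode n)"
    using binary_digits_exist[of "\<lambda>n. case_prod R (prod_decode n)"] by blast
  obtain f where f: "codes_real f x" using ex_codes_real by blast
  have "digit_rel f = R"
    unfolding digit_rel_iff[OF f x(1)] x(3) by simp
  then show "stage_less F i k"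
    unfolding stage_less_def presents_stage_order_iff[OF F]
    using f x(1,2) R \<open>R i k\<close> in_unit_iff[OF f] by blast
qed

section \<open>The code and its correctness\<close>

text \<open>This selects the intervals that make up an open set. The first three clauses give
  intervals disjoint from piece \<open>j\<close>, enough to exhaust its complement. The last two
  admit every interval if the piece is not inside \<open>- X\<close> (for \<open>s = 0\<close>) or
  \<open>X\<close> (otherwise), so that the open set becomes the whole line.\<close>

definition avoiding :: "type2 \<Rightarrow> nat \<Rightarrow> nat \<Rightarrow> nat \<Rightarrow> bool" where
  "avoiding F s j m \<longleftrightarrow>
     \<not> rat_at (fst (prod_decode j)) < rat_at (snd (prod_decode m)) \<or>
     \<not> rat_at (fst (prod_decode m)) < rat_at (snd (prod_decode j)) \<or>
     stage_less F m j \<or>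
     (s = 0 \<and> meets True F (stage_less F) j j) \<or> (s \<noteq> 0 \<and> meets False F (stage_less F) j j)"

lemma decidable_avoiding:
  assumes "s < k" "j < k" "m < k"
  shows "decidable k l (\<lambda>F v w. avoiding F (v s) (v j) (v m))"
proof -
  have "decidable k l (\<lambda>F v w. meets b F (stage_less F) (v j) (v j))" for b
    by (rule decidable_meets[where R = "\<lambda>F w. stage_less F"]) (intro assms decidable_stage_less
        Suc_mono zero_less_Suc)+
  then show ?thesis
    unfolding avoiding_def
    by (intro decidable_disj decidable_conj decidable_not decidable_rat_at_less
        computable_fst_prod_decode computable_snd_prod_decode
        computable_var decidable_eq computable_const decidable_stage_less assms)
qed

text \<open>The argument \<open>n\<close> codes \<open>(j, s, t, m, i)\<close>: piece \<open>j\<close>, its open (\<open>s = 0\<close>) or closed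
  (\<open>s = 1\<close>) part, left (\<open>t = 0\<close>) or right (\<open>t = 1\<close>) endpoint of the \<open>m\<close>-th interval, and the
  irrelevant position \<open>i\<close> in a constant sequence.  Intervals that should not contribute are made
  empty.\<close>

definition Delta_code :: "type2 \<Rightarrow> type1" where
  "Delta_code F n =
     (let j = fst (prod_decode n); n1 = snd (prod_decode n);
          s = fst (prod_decode n1); n2 = snd (prod_decode n1);
          t = fst (prod_decode n2); m = fst (prod_decode (snd (prod_decode n2)))
      in if t \<noteq> 0 \<and> avoiding F s j m then snd (prod_decode m) else fst (prod_decode m))"

lemma computable_Delta_code: "computable (Suc 0) 0 (\<lambda>F v w. Delta_code F (v 0))"
proof -
  \<comment> \<open>\<open>decidable_avoiding\<close> treats variables only; three successive
    bindings extend it to terms.\<close>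
  have av: "decidable (Suc 0) 0 (\<lambda>F v w. avoiding F (s F v w) (j F v w) (m F v w))"
    if "computable (Suc 0) 0 s" "computable (Suc 0) 0 j" "computable (Suc 0) 0 m" for s j m
  proof (rule decidable_let[OF that(1), where P = "\<lambda>F a v w. avoiding F a (j F v w) (m F v w)"],
      rule decidable_let[OF computable_shift[OF that(2)],
        where P = "\<lambda>F b v w. avoiding F (v 0) b (m F (\<lambda>i. v (Suc i)) w)"],
      rule decidable_let[OF computable_shift[OF computable_shift[OF that(3)]],
        where P = "\<lambda>F c v w. avoiding F (v (Suc 0)) (v 0) c"])
  qed (rule decidable_avoiding; simp)
  show ?thesis
    unfolding Delta_code_def Let_def
    by (intro computable_if decidable_conj decidable_not decidable_eq av
        computable_fst_prod_decode computable_snd_prod_decode computable_const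
        computable_var zero_less_Suc)
qed

lemma codes_real_const: "codes_real (\<lambda>_. a) (rat_at a)"
  unfolding codes_real_def rat_at_def by simp

lemma RM_code_open_Delta_code:
  "RM_code_open (row (row (Delta_code F) j) s)
     (\<Union>m. {lower m<..<(if avoiding F s j m then upper m else lower m)})"
proof -
  have "row (row (row (row (Delta_code F) j) s) 0) m = (\<lambda>_. fst (prod_decode m))" for m
    unfolding row_def Delta_code_def by simp
  moreover have "row (row (row (row (Delta_code F) j) s) 1) m
      = (\<lambda>_. if avoiding F s j m then snd (prod_decode m) else fst (prod_decode m))" for m
    unfolding row_def Delta_code_def by simp
  ultimately have "codes_real_seq (row (row (row (Delta_code F) j) s) 0) lower"
    "codes_real_seq (row (row (row (Delta_code F) j) s) 1)
       (\<lambda>m. if avoiding F s j m then upper m else lower m)"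
    unfolding codes_real_seq_def lower_def upper_def by (simp_all add: codes_real_const)
  then show ?thesis unfolding RM_code_open_def by blast
qed

lemma avoiding_iff:
  assumes "char_fun F X" "X \<in> Delta" "stage_order X R"
  shows "avoiding F s j m \<longleftrightarrow> upper m \<le> lower j \<or> upper j \<le> lower m \<or> R m j \<or>
    \<not> {lower j..upper j} \<inter> uncovered {i. R i j} \<subseteq> (if s = 0 then - X else X)"
  unfolding avoiding_def meets_iff[OF assms(1)] stage_less_eq[OF assms]
  by (auto simp: lower_def upper_def not_less)

lemma ex_interval_between:
  assumes "a < x" "x < b"
  obtains m where "x \<in> {lower m<..<upper m}" "a < lower m" "upper m < b"
proof -
  obtain c d where "a < rat_at c" "rat_at c < x" "x < rat_at d" "rat_at d < b"
    using ex_rat_at assms by metis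
  then show ?thesis using ex_interval[of c d] that by (metis greaterThanLessThan_iff)
qed

text \<open>A point outside \<open>C j\<close> lies left of interval \<open>j\<close>, right of it,
  or in an interval removed earlier. In each case some selected interval contains it.\<close>

lemma Union_avoiding:
  assumes "char_fun F X" "X \<in> Delta" "stage_order X R"
  defines "C j \<equiv> {lower j..upper j} \<inter> uncovered {i. R i j}"
  shows "(\<Union>m. {lower m<..<(if avoiding F s j m then upper m else lower m)})
    = (if C j \<subseteq> (if s = 0 then - X else X) then - C j else UNIV)"
proof (cases "C j \<subseteq> (if s = 0 then - X else X)")
  case False
  have "\<exists>m. x \<in> {lower m<..<upper m}" for x
    using ex_interval_between[of "x - 1" x "x + 1"] by (metis diff_less_eq less_add_one)
  then show ?thesis using False
    unfolding avoiding_iff[OF assms(1-3)] C_def[symmetric] by auto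
next
  case True
  have av: "avoiding F s j m \<longleftrightarrow> upper m \<le> lower j \<or> upper j \<le> lower m \<or> R m j" for m
    using True unfolding avoiding_iff[OF assms(1-3)] C_def[symmetric] by simp
  have "(\<Union>m. {lower m<..<(if avoiding F s j m then upper m else lower m)}) = - C j"
  proof (intro set_eqI iffI)
    fix x assume "x \<in> (\<Union>m. {lower m<..<(if avoiding F s j m then upper m else lower m)})"
    then obtain m where m: "avoiding F s j m" "x \<in> {lower m<..<upper m}"
      by (auto split: if_splits)
    then show "x \<in> - C j" unfolding av C_def uncovered_def by auto
  next
    fix x assume "x \<in> - C j"
    then consider "x < lower j" | "upper j < x" | i where "R i j" "x \<in> {lower i<..<upper i}"
      unfolding C_def uncovered_def by fastforce
    then have "\<exists>m. avoiding F s j m \<and> x \<in> {lower m<..<upper m}"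
    proof cases
      case 1
      then obtain m where "x \<in> {lower m<..<upper m}" "upper m < lower j"
        using ex_interval_between[of "x - 1" x "lower j"] by auto
      then show ?thesis unfolding av by (intro exI[of _ m]) simp
    next
      case 2
      then obtain m where "x \<in> {lower m<..<upper m}" "upper j < lower m"
        using ex_interval_between[of "upper j" x "x + 1"] by auto
      then show ?thesis unfolding av by (intro exI[of _ m]) simp
    next
      case 3
      then show ?thesis unfolding av by blast
    qed
    then obtain m where "avoiding F s j m" "x \<in> {lower m<..<upper m}" by blast
    then show "x \<in> (\<Union>m. {lower m<..<(if avoiding F s j m then upper m else lower m)})"
      by (intro UN_I[of m]) simp_all
  qed
  then show ?thesis using True by simp
qed

text \<open>The pieces cover the line and each lies in \<open>X\<close> or in \<open>- X\<close>. So
  \<open>X\<close> is the union of the pieces inside it, and also the intersection of the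
  complements of the pieces inside \<open>- X\<close>.\<close>

lemma RM_code_Delta_Delta_code:
  assumes F: "char_fun F X" and X: "X \<in> Delta"
  shows "RM_code_Delta (Delta_code F) X"
proof -
  obtain R where R: "stage_order X R" using ex_stage_order[OF X] by blast
  define C where "C j = {lower j..upper j} \<inter> uncovered {i. R i j}" for j
  define U where "U j = (if C j \<subseteq> - X then - C j else UNIV)" for j
  define K where "K j = (if C j \<subseteq> X then C j else {})" for j
  have "RM_code_open (row (row (Delta_code F) j) 0) (U j)" for j
    using RM_code_open_Delta_code[of F j 0] Union_avoiding[OF F X R, of 0 j]
    unfolding U_def C_def by simp
  moreover have "RM_code_closed (row (row (Delta_code F) j) 1) (K j)" for j
  proof -
    have "- K j = (if C j \<subseteq> X then - C j else UNIV)" unfolding K_def by simp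
    then show ?thesis
      using RM_code_open_Delta_code[of F j 1] Union_avoiding[OF F X R, of 1 j]
      unfolding C_def RM_code_closed_def by simp
  qed
  moreover have cover: "\<exists>j. x \<in> C j \<and> (C j \<subseteq> X \<or> C j \<subseteq> - X)" for x
    using stage_order_cover[OF X R, of x] stage_order_homogeneous[OF X R]
    unfolding C_def homogeneous_def by blast
  have "X = (\<Inter>j. U j)"
  proof
    show "X \<subseteq> (\<Inter>j. U j)" unfolding U_def by auto
    show "(\<Inter>j. U j) \<subseteq> X"
    proof
      fix x assume "x \<in> (\<Inter>j. U j)"
      then have x: "x \<in> U j" for j by blast
      obtain j where "x \<in> C j" "C j \<subseteq> X \<or> C j \<subseteq> - X" using cover by blast
      then show "x \<in> X" using x[of j] unfolding U_def by (auto split: if_splits)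
    qed
  qed
  moreover have "X = (\<Union>j. K j)"
  proof
    show "(\<Union>j. K j) \<subseteq> X" unfolding K_def by auto
    show "X \<subseteq> (\<Union>j. K j)"
    proof
      fix x assume "x \<in> X"
      obtain j where "x \<in> C j" "C j \<subseteq> X \<or> C j \<subseteq> - X" using cover by blast
      then have "x \<in> K j" using \<open>x \<in> X\<close> unfolding K_def by auto
      then show "x \<in> (\<Union>j. K j)" by blast
    qed
  qed
  ultimately show ?thesis unfolding RM_code_Delta_def by blast
qed

text \<open>\<open>avoiding_iff\<close> describes the selection by \<open>X\<close> and its stage
  order alone, so the code depends on the set and not on its presentation.\<close>

lemma Delta_code_cong:
  assumes "char_fun F X" "char_fun G X" "X \<in> Delta"
  shows "Delta_code F = Delta_code G"
proof -
  obtain R where R: "stage_order X R" using ex_stage_order[OF assms(3)] by blast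
  have "avoiding F = avoiding G"
    by (intro ext) (simp only: avoiding_iff[OF assms(1,3) R] avoiding_iff[OF assms(2,3) R])
  then show ?thesis unfolding Delta_code_def[abs_def] by simp
qed

lemma ex_char_fun: "\<exists>F. char_fun F X"
proof -
  have "char_fun (\<lambda>f. if lim (\<lambda>n. rat_at (f n)) \<in> X then 1 else 0) X"
    unfolding char_fun_def using limI[OF codes_realD] by simp
  then show ?thesis by blast
qed

theorem theorem3p7:
  shows "\<exists>\<Phi> :: real set \<Rightarrow> nat \<Rightarrow> nat.
           computable_on Delta \<Phi> [exists2] [type3_of Omega_Delta] \<and>
           (\<forall>X \<in> Delta. RM_code_Delta (\<Phi> X) X)"
proof (intro exI conjI ballI)
  \<comment> \<open>One presentation of each set is chosen to define the functional;
    \<open>Delta_code_cong\<close> transfers the value to every other presentation.\<close>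
  let ?\<Phi> = "\<lambda>X. Delta_code (SOME F. char_fun F X)"
  have some: "char_fun (SOME F. char_fun F X) X" for X
    by (rule someI_ex[OF ex_char_fun])
  obtain e where e: "\<And>F v w. presents_Delta F \<Longrightarrow>
     kleene e (map v [0..<Suc 0]) (map w [0..<0]) [F, exists2] [type3_of Omega_Delta]
       (Delta_code F (v 0))"
    using computable_Delta_code unfolding computable_def by blast
  have "kleene e [n] [] [F, exists2] [type3_of Omega_Delta] (?\<Phi> X n)"
    if "X \<in> Delta" "char_fun F X" for X F n
  proof -
    have "presents_Delta F" using that unfolding presents_Delta_def by blast
    then show ?thesis
      using e[of F "\<lambda>_. n"] Delta_code_cong[OF that(2) some that(1)] by simp
  qed
  then show "computable_on Delta ?\<Phi> [exists2] [type3_of Omega_Delta]"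
    unfolding computable_on_def by blast
  show "RM_code_Delta (?\<Phi> X) X" if "X \<in> Delta" for X
    using RM_code_Delta_Delta_code[OF some that] .
qed

end
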